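(* Let $K$ be a field of characteristic $0$, let $n\geq 1$, let $X=\{x_1,\ldots,x_n\}$, $Y=\{y_1,\ldots,y_n\}$, and let $\Delta$ be the derivation of $K[X,Y]=K[x_1,\ldots,x_n,y_1,\ldots,y_n]$ defined by \[ \Delta=\sum_{i=1}^n x_i\frac{\partial}{\partial y_i}. \] Let $U=\{u_{ij}\mid 1\leq i<j\leq n\}$ be a set of further independent variables, and let $K[X,U]$ be the polynomial algebra in the variables $x_1,\ldots,x_n$ and $u_{ij}$, $1\leq i<j\leq n$. Then: (i) The algebra of constants $K[X,Y]^{\Delta}$, with respect to the generators $x_i$ ($1\le i\le n$) and $x_iy_j-x_jy_i$ ($1\leq i<j\leq n$) corresponding to the variables $x_i$ and $u_{ij}$ respectively, has the presentation \[ K[X,Y]^{\Delta}\cong K[X,U]/(R,S), \] where $(R,S)$ is the ideal of $K[X,U]$ generated by \[ R=\{r(i,j,k,l)=u_{ij}u_{kl}-u_{ik}u_{jl}+u_{il}u_{jk}\mid 1\leq i<j<k<l\leq n\}, \] \[ S=\{s(i,j,k)=x_iu_{jk}-x_ju_{ik}+x_ku_{ij}\mid 1\leq i<j<k\leq n\}. \] (ii) The set $R\cup S$ is the reduced Gröbner basis of the ideal $(R,S)$ with respect to the DILL order of $K[X,U]$. (iii) As a vector space over $K$, $K[X,Y]^{\Delta}$ has a basis consisting of all products \[ x_{i_1}\cdots x_{i_c}u_{j_1k_1}\cdots u_{j_dk_d} \] (where here $u_{jk}$ denotes the element $x_jy_k-x_ky_j$ of $K[X,Y]$, $j<k$) such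 that the generators $u_{j_pk_p}$ and $u_{j_qk_q}$ do not intersect each other and $u_{j_pk_p}$ does not cover $x_{i_t}$, for any $p,q,t$.
   Context: The derivation $\Delta$ is $K$-linear, satisfies the Leibniz rule, and acts by $\Delta(x_i)=0$, $\Delta(y_i)=x_i$. The algebra of constants is $K[X,Y]^{\Delta}=\{f\in K[X,Y]:\Delta(f)=0\}$. The presentation in (i) refers to the algebra homomorphism $K[X,U]\to K[X,Y]^{\Delta}$ sending $x_i\mapsto x_i$ and $u_{jk}\mapsto x_jy_k-x_ky_j$. Intersecting and covering. The generator $u_{ij}$ ($i<j$) is identified with the open interval $(i,j)$ of the real line, and its interval length is $|u_{ij}|=j-i$. The generators $u_{ij}$ and $u_{kl}$ intersect each other if the intervals $(i,j)$ and $(k,l)$ have nonempty intersection and neither is contained in the other, i.e. if $i<k<j<l$ or $k<i<l<j$. The generator $u_{ij}$ covers $x_k$ if $i<k<j$. In (iii), products are commutative (products differing only by the order of factors are the same), $c,d\ge 0$, and repeated factors are allowed. DILL (degree--interval length--lexicographic) order. Write monomials of $K[X,U]$ as $v=x_{i_1}\cdots x_{i_c}u_{j_1k_1}\cdots u_{j_dk_d}$ with $i_1\leq\cdots\leq i_c$, $j_1\leq\cdots\leq j_d$, and $k_a\leq k_{a+1}$ whenever $j_a=j_{a+1}$; similarly $v'=x_{i'_1}\cdots x_{i'_{c'}}u_{j'_1k'_1}\cdots u_{j'_{d'}k'_{d'}}$. Then $v\succ v'$ if one of the following holds: (1) $c>c'$; (2) $c=c'$ and $d>d'$; (3) $c=c'$,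 $d=d'$ and $\sum_{b=1}^d|u_{j_bk_b}|>\sum_{b=1}^d|u_{j'_bk'_b}|$; (4) $c=c'$, $d=d'$, $\sum_{b=1}^d|u_{j_bk_b}|=\sum_{b=1}^d|u_{j'_bk'_b}|$ and $\omega\succ\omega'$ for the $(c+2d)$-tuples $\omega=(i_1,\ldots,i_c,j_1,\ldots,j_d,k_1,\ldots,k_d)$ and $\omega'=(i'_1,\ldots,i'_c,j'_1,\ldots,j'_d,k'_1,\ldots,k'_d)$, where $(a_1,\ldots,a_p)\succ(b_1,\ldots,b_p)$ means that $a_1=b_1,\ldots,a_e=b_e$ and $a_{e+1}<b_{e+1}$ for some $e\geq 0$. This is an admissible order (a linear order on monomials satisfying the descending chain condition and such that $u\succ v$ implies $uw\succ vw$ for all monomials $w$). Gröbner bases. For a nonzero polynomial $f$, $\overline{f}$ denotes its leading (i.e. $\succ$-largest) monomial. A generating set $G$ of an ideal $J$ is a Gröbner basis of $J$ if for every nonzero $f\in J$ there is $g\in G$ such that $\overline{f}$ is divisible by $\overline{g}$. A Gröbner basis $G$ is reduced if, for each $g\in G$, none of the monomials occurring in $g$ is divisible by the leading monomial of an element of $G\setminus\{g\}$ (leading coefficients are not required to be $1$, so elements are considered up to nonzero scalar multiples). *)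

theory Defs
  imports Complex_Main "HOL-Library.Poly_Mapping" "HOL-Library.Multiset" "HOL-Algebra.QuotRing"
begin

section \<open>Polynomials\<close>

datatype var = X nat | Y nat | U nat nat

type_synonym monomial = "var \<Rightarrow>\<^sub>0 nat"

type_synonym 'k mpoly = "monomial \<Rightarrow>\<^sub>0 'k"

definition pvar :: "var \<Rightarrow> 'k::comm_ring_1 mpoly" where
  "pvar v = Poly_Mapping.single (Poly_Mapping.single v 1) 1"

definition pconst :: "'k \<Rightarrow> 'k::comm_ring_1 mpoly" where
  "pconst c = Poly_Mapping.single 0 c"

definition scale :: "'k \<Rightarrow> 'k mpoly \<Rightarrow> 'k::comm_ring_1 mpoly" where
  "scale c f = pconst c * f"

abbreviation xv :: "nat \<Rightarrow> 'k::comm_ring_1 mpoly" where "xv i \<equiv> pvar (X i)"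
abbreviation yv :: "nat \<Rightarrow> 'k::comm_ring_1 mpoly" where "yv i \<equiv> pvar (Y i)"
abbreviation uv :: "nat \<Rightarrow> nat \<Rightarrow> 'k::comm_ring_1 mpoly" where "uv i j \<equiv> pvar (U i j)"

text \<open>The polynomial ring over the coefficient type in the set of variables \<open>V\<close>, as a ring
  in the sense of \<open>HOL-Algebra\<close>.\<close>

definition poly_ring :: "var set \<Rightarrow> 'k::comm_ring_1 mpoly ring" where
  "poly_ring V = \<lparr>carrier = {f. \<forall>m \<in> Poly_Mapping.keys f. Poly_Mapping.keys m \<subseteq> V},
                  mult = (*), one = 1, zero = 0, add = (+)\<rparr>"

lemma vector_space_scale: "vector_space (scale :: 'k::field \<Rightarrow> _)"
  by unfold_locales
    (auto simp: scale_def pconst_def distrib_left distrib_right single_add mult_single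
      mult.assoc [symmetric])

lemma carrier_poly_ring:
  "f \<in> carrier (poly_ring V) \<longleftrightarrow> (\<forall>m\<in>Poly_Mapping.keys f. Poly_Mapping.keys m \<subseteq> V)"
  by (simp add: poly_ring_def)

lemma cring_poly_ring: "cring (poly_ring V :: 'k::comm_ring_1 mpoly ring)"
proof -
  let ?C = "carrier (poly_ring V :: 'k mpoly ring)"
  have zero: "0 \<in> ?C" and one: "1 \<in> ?C"
    by (auto simp: poly_ring_def)
  have add: "f + g \<in> ?C" if "f \<in> ?C" "g \<in> ?C" for f g
    using that Poly_Mapping.keys_add[of f g] unfolding carrier_poly_ring by blast
  have mult: "f * g \<in> ?C" if "f \<in> ?C" "g \<in> ?C" for f g
    unfolding carrier_poly_ring
  proof
    fix m assume "m \<in> Poly_Mapping.keys (f * g)"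
    then obtain a b where m: "m = a + b" "a \<in> Poly_Mapping.keys f" "b \<in> Poly_Mapping.keys g"
      using keys_mult[of f g] by blast
    then have "Poly_Mapping.keys a \<subseteq> V" "Poly_Mapping.keys b \<subseteq> V"
      using that unfolding carrier_poly_ring by blast+
    then show "Poly_Mapping.keys m \<subseteq> V"
      using Poly_Mapping.keys_add[of a b] m(1) by blast
  qed
  have uminus: "- f \<in> ?C" if "f \<in> ?C" for f
    using that by (simp add: carrier_poly_ring)
  have ops: "(\<otimes>\<^bsub>poly_ring V\<^esub>) = ((*) :: 'k mpoly \<Rightarrow> _)" "(\<oplus>\<^bsub>poly_ring V\<^esub>) = ((+) :: 'k mpoly \<Rightarrow> _)"
    "\<one>\<^bsub>poly_ring V\<^esub> = (1 :: 'k mpoly)" "\<zero>\<^bsub>poly_ring V\<^esub> = (0 :: 'k mpoly)"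
    by (simp_all add: poly_ring_def)
  have inverse: "\<exists>g \<in> ?C. g + f = 0" if "f \<in> ?C" for f
    using uminus[OF that] by (intro bexI[of _ "- f"]) simp_all
  show ?thesis
  proof (rule cringI)
    show "abelian_group (poly_ring V :: 'k mpoly ring)"
      by (rule abelian_groupI; unfold ops) (assumption | rule zero add.assoc add.commute add_0 inverse add)+
    show "comm_monoid (poly_ring V :: 'k mpoly ring)"
      by (rule comm_monoidI; unfold ops) (assumption | rule one mult.assoc mult.commute mult_1 mult)+
  qed (unfold ops, rule distrib_right)
qed

definition XY :: "nat \<Rightarrow> var set" where
  "XY n = X ` {1..n} \<union> Y ` {1..n}"

definition XU :: "nat \<Rightarrow> var set" where
  "XU n = X ` {1..n} \<union> {U i j | i j. 1 \<le> i \<and> i < j \<and> j \<le> n}"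

text \<open>Substitution of polynomials for the variables; it is the \<open>K\<close>-algebra homomorphism that
  maps each variable \<open>v\<close> to \<open>\<sigma> v\<close>.\<close>

definition psubst :: "(var \<Rightarrow> 'k mpoly) \<Rightarrow> 'k mpoly \<Rightarrow> 'k::comm_ring_1 mpoly" where
  "psubst \<sigma> f = (\<Sum>m \<in> Poly_Mapping.keys f.
     scale (Poly_Mapping.lookup f m)
       (\<Prod>v \<in> Poly_Mapping.keys m. \<sigma> v ^ Poly_Mapping.lookup m v))"

lemma psubst_pvar: "psubst \<sigma> (pvar v) = \<sigma> v"
  by (simp add: psubst_def pvar_def scale_def pconst_def single_one)

lemma psubst_pconst: "psubst \<sigma> (pconst c) = pconst c"
  by (simp add: psubst_def scale_def pconst_def)

definition partial_deriv :: "var \<Rightarrow> 'k mpoly \<Rightarrow> 'k::comm_ring_1 mpoly" where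
  "partial_deriv v f = (\<Sum>m \<in> Poly_Mapping.keys f.
     Poly_Mapping.single (m - Poly_Mapping.single v 1)
       (of_nat (Poly_Mapping.lookup m v) * Poly_Mapping.lookup f m))"


section \<open>The algebra of constants and its presentation\<close>

definition Delta :: "nat \<Rightarrow> 'k mpoly \<Rightarrow> 'k::comm_ring_1 mpoly" where
  "Delta n f = (\<Sum>i = 1..n. xv i * partial_deriv (Y i) f)"

lemma Delta_x: "Delta n (xv i) = (0 :: 'k::comm_ring_1 mpoly)"
  by (simp add: Delta_def partial_deriv_def pvar_def lookup_single)

lemma Delta_y: "i \<in> {1..n} \<Longrightarrow> Delta n (yv i) = (xv i :: 'k::comm_ring_1 mpoly)"
proof -
  assume i: "i \<in> {1..n}"
  have "Delta n (yv i) = (\<Sum>j=1..n. if j = i then xv i else (0::'k mpoly))"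
    unfolding Delta_def
    by (rule sum.cong) (auto simp: partial_deriv_def pvar_def lookup_single single_one)
  then show ?thesis using i by simp
qed

definition constants_ring :: "nat \<Rightarrow> 'k::comm_ring_1 mpoly ring" where
  "constants_ring n =
     (poly_ring (XY n)) \<lparr>carrier := {f \<in> carrier (poly_ring (XY n)). Delta n f = 0}\<rparr>"

definition minor :: "nat \<Rightarrow> nat \<Rightarrow> 'k::comm_ring_1 mpoly" where
  "minor j k = xv j * yv k - xv k * yv j"

text \<open>The value at the variables \<open>Y i\<close> is immaterial, as they do not occur in \<open>K[X,U]\<close>.\<close>

fun generator :: "var \<Rightarrow> 'k::comm_ring_1 mpoly" where
  "generator (X i) = xv i"
| "generator (U j k) = minor j k"
| "generator (Y i) = yv i"

definition presentation_map :: "'k mpoly \<Rightarrow> 'k::comm_ring_1 mpoly" where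
  "presentation_map = psubst generator"

definition rel_r :: "nat \<Rightarrow> nat \<Rightarrow> nat \<Rightarrow> nat \<Rightarrow> 'k::comm_ring_1 mpoly" where
  "rel_r i j k l = uv i j * uv k l - uv i k * uv j l + uv i l * uv j k"

definition rel_s :: "nat \<Rightarrow> nat \<Rightarrow> nat \<Rightarrow> 'k::comm_ring_1 mpoly" where
  "rel_s i j k = xv i * uv j k - xv j * uv i k + xv k * uv i j"

definition rels_R :: "nat \<Rightarrow> 'k::comm_ring_1 mpoly set" where
  "rels_R n = {rel_r i j k l | i j k l. 1 \<le> i \<and> i < j \<and> j < k \<and> k < l \<and> l \<le> n}"

definition rels_S :: "nat \<Rightarrow> 'k::comm_ring_1 mpoly set" where
  "rels_S n = {rel_s i j k | i j k. 1 \<le> i \<and> i < j \<and> j < k \<and> k \<le> n}"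

definition rel_ideal :: "nat \<Rightarrow> 'k::comm_ring_1 mpoly set" where
  "rel_ideal n = genideal (poly_ring (XU n)) (rels_R n \<union> rels_S n)"


section \<open>The DILL order\<close>

text \<open>The monomial with factors \<open>x\<^sub>i\<close> for \<open>i\<close> in \<open>is\<close> and \<open>u\<^sub>j\<^sub>k\<close> for \<open>(j, k)\<close> in \<open>us\<close>.\<close>

definition xu_monomial :: "nat list \<Rightarrow> (nat \<times> nat) list \<Rightarrow> monomial" where
  "xu_monomial is us = (\<Sum>i\<leftarrow>is. Poly_Mapping.single (X i) 1)
                     + (\<Sum>(j, k)\<leftarrow>us. Poly_Mapping.single (U j k) 1)"

definition standard_form :: "nat list \<Rightarrow> (nat \<times> nat) list \<Rightarrow> bool" where
  "standard_form is us \<longleftrightarrow>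
     sorted is \<and> sorted_wrt (\<lambda>(j, k) (j', k'). j < j' \<or> j = j' \<and> k \<le> k') us"

definition total_length :: "(nat \<times> nat) list \<Rightarrow> nat" where
  "total_length us = (\<Sum>(j, k)\<leftarrow>us. k - j)"

definition exponent_tuple :: "nat list \<Rightarrow> (nat \<times> nat) list \<Rightarrow> nat list" where
  "exponent_tuple is us = is @ map fst us @ map snd us"

text \<open>In the last case the tuples have equal length, and the tuple with the smaller entry at the
  first difference belongs to the larger monomial.\<close>

definition dill_greater :: "monomial \<Rightarrow> monomial \<Rightarrow> bool" where
  "dill_greater v v' \<longleftrightarrow> (\<exists>is us is' us'.
     standard_form is us \<and> v = xu_monomial is us \<and>
     standard_form is' us' \<and> v' = xu_monomial is' us' \<and>
     (length is > length is' \<or>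
      length is = length is' \<and> length us > length us' \<or>
      length is = length is' \<and> length us = length us' \<and> total_length us > total_length us' \<or>
      length is = length is' \<and> length us = length us' \<and> total_length us = total_length us' \<and>
        (exponent_tuple is us, exponent_tuple is' us') \<in> lex less_than))"


section \<open>Groebner bases\<close>

definition mono_dvd :: "monomial \<Rightarrow> monomial \<Rightarrow> bool" where
  "mono_dvd a b \<longleftrightarrow> (\<exists>c. b = a + c)"

definition leading_monomial ::
    "(monomial \<Rightarrow> monomial \<Rightarrow> bool) \<Rightarrow> 'k::zero mpoly \<Rightarrow> monomial" where
  "leading_monomial gt f = (THE m. m \<in> Poly_Mapping.keys f \<and>
     (\<forall>m' \<in> Poly_Mapping.keys f. m' \<noteq> m \<longrightarrow> gt m m'))"

definition groebner_basis ::
    "(monomial \<Rightarrow> monomial \<Rightarrow> bool) \<Rightarrow> 'k::comm_ring_1 mpoly ring \<Rightarrow>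
     'k mpoly set \<Rightarrow> 'k mpoly set \<Rightarrow> bool" where
  "groebner_basis gt P J G \<longleftrightarrow>
     G \<subseteq> carrier P \<and> genideal P G = J \<and>
     (\<forall>f \<in> J. f \<noteq> 0 \<longrightarrow>
        (\<exists>g \<in> G. g \<noteq> 0 \<and> mono_dvd (leading_monomial gt g) (leading_monomial gt f)))"

definition reduced_groebner_basis ::
    "(monomial \<Rightarrow> monomial \<Rightarrow> bool) \<Rightarrow> 'k::comm_ring_1 mpoly ring \<Rightarrow>
     'k mpoly set \<Rightarrow> 'k mpoly set \<Rightarrow> bool" where
  "reduced_groebner_basis gt P J G \<longleftrightarrow>
     groebner_basis gt P J G \<and> 0 \<notin> G \<and>
     (\<forall>g \<in> G. \<forall>m \<in> Poly_Mapping.keys g. \<forall>h \<in> G - {g}.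
        \<not> mono_dvd (leading_monomial gt h) m)"


section \<open>The basis of the algebra of constants\<close>

fun intersecting :: "nat \<times> nat \<Rightarrow> nat \<times> nat \<Rightarrow> bool" where
  "intersecting (i, j) (k, l) \<longleftrightarrow> (i < k \<and> k < j \<and> j < l) \<or> (k < i \<and> i < l \<and> l < j)"

fun covers :: "nat \<times> nat \<Rightarrow> nat \<Rightarrow> bool" where
  "covers (i, j) k \<longleftrightarrow> i < k \<and> k < j"

text \<open>A commutative product of generators is given by the multiset of the indices \<open>i\<close> of its
  factors \<open>x\<^sub>i\<close> and the multiset of the index pairs \<open>(j, k)\<close> of its factors \<open>u\<^sub>j\<^sub>k\<close>.\<close>

definition admissible_products :: "nat \<Rightarrow> (nat multiset \<times> (nat \<times> nat) multiset) set" where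
  "admissible_products n = {(I, E).
     (\<forall>i \<in># I. 1 \<le> i \<and> i \<le> n) \<and>
     (\<forall>(j, k) \<in># E. 1 \<le> j \<and> j < k \<and> k \<le> n) \<and>
     (\<forall>p \<in># E. \<forall>q \<in># E. \<not> intersecting p q) \<and>
     (\<forall>p \<in># E. \<forall>i \<in># I. \<not> covers p i)}"

definition generator_product ::
    "nat multiset \<times> (nat \<times> nat) multiset \<Rightarrow> 'k::comm_ring_1 mpoly" where
  "generator_product = (\<lambda>(I, E). (\<Prod>i \<in># I. xv i) * (\<Prod>(j, k) \<in># E. minor j k))"

end

theory Submission
  imports Defs "HOL-Library.Product_Lexorder" "HOL-Algebra.Subrings"
begin

text \<open>
  Setting \<open>x\<^sub>k = u\<^sub>0\<^sub>k\<close> turns the relations \<open>s\<close> into Pluecker relations as well, and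
  ``\<open>u\<^sub>i\<^sub>j\<close> covers \<open>x\<^sub>k\<close>'' into ``\<open>(i, j)\<close> crosses \<open>(0, k)\<close>''; so everything is about noncrossing arcs.

  Each relation rewrites a forbidden pair of factors into DILL-smaller products, hence modulo the
  ideal every polynomial is a combination of admissible products. Conversely, give \<open>y\<^sub>i\<close> weight
  \<open>i\<close>: the unique heaviest monomial of an admissible product is obtained by choosing \<open>x\<^sub>jy\<^sub>k\<close>
  (\<open>j < k\<close>) in each factor \<open>x\<^sub>jy\<^sub>k - x\<^sub>ky\<^sub>j\<close>. Reading it as a word of brackets, \<open>x\<^sub>j\<close> opening
  and \<open>y\<^sub>k\<close> closing, the arcs are recovered by matching the brackets, so admissible products are
  linearly independent. This gives the Groebner basis and the kernel of the presentation.

  For surjectivity let \<open>A\<close> be the span of the admissible products. As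
  \<open>x\<^sub>1y\<^sub>j = x\<^sub>jy\<^sub>1 + u\<^sub>1\<^sub>j\<close>, a power of \<open>x\<^sub>1\<close> carries any \<open>f\<close> into \<open>A[y\<^sub>1]\<close>, and \<open>y\<^sub>1\<close> is
  transcendental over the constants in characteristic \<open>0\<close>; so \<open>x\<^sub>1\<^sup>N f \<in> A\<close> for a constant \<open>f\<close>.
  The factor \<open>x\<^sub>1\<close> can be cancelled because the admissible products without it stay independent
  modulo \<open>x\<^sub>1\<close>, by the same leading monomial argument.
\<close>

section \<open>Substitutions and derivations\<close>

interpretation mp: vector_space "scale :: 'k::field \<Rightarrow> 'k mpoly \<Rightarrow> 'k mpoly"
  by (rule vector_space_scale)

lemma scale_mult: "scale c f * g = scale c (f * g)" "f * scale c g = scale c (f * g)"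
  by (simp_all add: scale_def ac_simps)

lemma scale_times_scale: "scale (c * d) (f * g) = scale c f * scale d g"
proof -
  have "pconst (c * d) = pconst c * pconst d" by (simp add: pconst_def mult_single)
  then show ?thesis by (simp only: scale_def ac_simps)
qed

lemma scale_single: "scale c (Poly_Mapping.single m d) = Poly_Mapping.single m (c * d)"
  by (simp add: scale_def pconst_def mult_single)

text \<open>Adding a fresh key to the support is adding one term, so additive statements reduce to
  single terms and bilinear ones to a nested induction.\<close>

lemma mpoly_induct [case_names single add]:
  fixes f :: "'k::comm_ring_1 mpoly"
  assumes single: "\<And>m c. P (Poly_Mapping.single m c)"
    and add: "\<And>f g. P f \<Longrightarrow> P g \<Longrightarrow> P (f + g)"
  shows "P f"
proof (induction f rule: Poly_Mapping.update_induct)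
  case (const)
  then show ?case using single[of 0 0] by simp
next
  case (update f a b)
  have "Poly_Mapping.update a b f = f + Poly_Mapping.single a b"
    using update.hyps
    by (intro poly_mapping_eqI) (auto simp: lookup_update lookup_add lookup_single in_keys_iff when_def)
  then show ?case using add[OF update.IH single] by simp
qed

lemma mpoly_expand:
  "f = (\<Sum>m\<in>Poly_Mapping.keys f. Poly_Mapping.single m (Poly_Mapping.lookup f m))"
proof (rule poly_mapping_eqI)
  fix k
  show "Poly_Mapping.lookup f k
    = Poly_Mapping.lookup (\<Sum>m\<in>Poly_Mapping.keys f. Poly_Mapping.single m (Poly_Mapping.lookup f m)) k"
    by (cases "k \<in> Poly_Mapping.keys f")
      (auto simp: lookup_sum lookup_single when_def in_keys_iff sum.delta)
qed

text \<open>The inner product of \<open>psubst\<close>, isolated because multiplicativity of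
  \<open>psubst\<close> rests on \<open>mono_value_add\<close>.\<close>

definition mono_value :: "(var \<Rightarrow> 'k mpoly) \<Rightarrow> monomial \<Rightarrow> 'k::comm_ring_1 mpoly" where
  "mono_value \<sigma> m = (\<Prod>v \<in> Poly_Mapping.keys m. \<sigma> v ^ Poly_Mapping.lookup m v)"

text \<open>The added factors are zeroth powers. Two monomials can thus be evaluated over one common
  set of variables.\<close>

lemma mono_value_superset:
  assumes "finite S" "Poly_Mapping.keys m \<subseteq> S"
  shows "mono_value \<sigma> m = (\<Prod>v \<in> S. \<sigma> v ^ Poly_Mapping.lookup m v)"
  unfolding mono_value_def using assms
  by (intro prod.mono_neutral_left) (auto simp: in_keys_iff)

lemma mono_value_add: "mono_value \<sigma> (a + b) = mono_value \<sigma> a * mono_value \<sigma> b"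
proof -
  let ?S = "Poly_Mapping.keys a \<union> Poly_Mapping.keys b"
  have "mono_value \<sigma> (a + b) = (\<Prod>v \<in> ?S. \<sigma> v ^ Poly_Mapping.lookup (a + b) v)"
    by (rule mono_value_superset) (auto simp: Poly_Mapping.keys_add)
  also have "\<dots> = mono_value \<sigma> a * mono_value \<sigma> b"
    by (simp add: mono_value_superset[of ?S] lookup_add power_add prod.distrib)
  finally show ?thesis .
qed

lemma mono_value_single: "mono_value \<sigma> (Poly_Mapping.single v k) = \<sigma> v ^ k"
  by (simp add: mono_value_def)

lemma mono_value_0 [simp]: "mono_value \<sigma> 0 = 1"
  by (simp add: mono_value_def)

lemma mono_value_eq_monomial:
  "mono_value pvar m = (Poly_Mapping.single m 1 :: 'k::comm_ring_1 mpoly)"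
proof (induction m rule: Poly_Mapping.update_induct)
  case const
  then show ?case by (simp add: single_one)
next
  case (update m v k)
  have eq: "Poly_Mapping.update v k m = m + Poly_Mapping.single v k"
    using update.hyps
    by (intro poly_mapping_eqI) (auto simp: lookup_update lookup_add lookup_single in_keys_iff when_def)
  have "(pvar v :: 'k mpoly) ^ k = Poly_Mapping.single (Poly_Mapping.single v k) 1" for k
    by (induction k) (simp_all add: single_one pvar_def mult_single flip: single_add)
  then show ?case
    by (simp add: eq mono_value_add update.IH mono_value_single mult_single)
qed

lemma psubst_superset:
  assumes "finite S" "Poly_Mapping.keys f \<subseteq> S"
  shows "psubst \<sigma> f = (\<Sum>m\<in>S. scale (Poly_Mapping.lookup f m) (mono_value \<sigma> m))"
  unfolding psubst_def mono_value_def using assms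
  by (intro sum.mono_neutral_left) (auto simp: in_keys_iff scale_def pconst_def)

lemma psubst_add: "psubst \<sigma> (f + g) = psubst \<sigma> f + psubst \<sigma> g"
proof -
  let ?S = "Poly_Mapping.keys f \<union> Poly_Mapping.keys g"
  have "psubst \<sigma> (f + g) = (\<Sum>m\<in>?S. scale (Poly_Mapping.lookup (f + g) m) (mono_value \<sigma> m))"
    by (rule psubst_superset) (auto simp: Poly_Mapping.keys_add)
  also have "\<dots> = psubst \<sigma> f + psubst \<sigma> g"
    by (simp add: psubst_superset[of ?S] lookup_add scale_def pconst_def single_add distrib_right
        sum.distrib)
  finally show ?thesis .
qed

lemma psubst_single: "psubst \<sigma> (Poly_Mapping.single m c) = scale c (mono_value \<sigma> m)"
  by (subst psubst_superset[of "{m}"]) auto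

lemma psubst_0 [simp]: "psubst \<sigma> 0 = 0"
  by (simp add: psubst_def)

lemma psubst_mult: "psubst \<sigma> (f * g) = psubst \<sigma> f * psubst \<sigma> g"
proof (induction f rule: mpoly_induct)
  case (single a c)
  show ?case
  proof (induction g rule: mpoly_induct)
    case (single b d)
    show ?case
      by (simp add: mult_single psubst_single mono_value_add scale_times_scale)
  qed (simp add: distrib_left psubst_add)
qed (simp add: distrib_right psubst_add)

lemma psubst_1 [simp]: "psubst \<sigma> 1 = 1"
  using psubst_pconst[of \<sigma> 1] by (simp add: pconst_def single_one)

lemma psubst_scale: "psubst \<sigma> (scale c f) = scale c (psubst \<sigma> f)"
  by (simp add: scale_def psubst_mult psubst_pconst)

lemma psubst_uminus: "psubst \<sigma> (- f) = - psubst \<sigma> f"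
  using psubst_add[of \<sigma> "- f" f] by (simp add: eq_neg_iff_add_eq_0)

lemma psubst_diff: "psubst \<sigma> (f - g) = psubst \<sigma> f - psubst \<sigma> g"
  using psubst_add[of \<sigma> f "- g"] by (simp add: psubst_uminus)

lemma psubst_sum: "psubst \<sigma> (sum f A) = (\<Sum>a\<in>A. psubst \<sigma> (f a))"
  by (induction A rule: infinite_finite_induct) (simp_all add: psubst_add)

lemma psubst_prod_mset: "psubst \<sigma> (\<Prod>a\<in>#A. f a) = (\<Prod>a\<in>#A. psubst \<sigma> (f a))"
  by (induction A) (simp_all add: psubst_mult)

section \<open>The Leibniz rule for partial derivatives and for \<open>Delta\<close>\<close>

lemma partial_deriv_superset:
  assumes "finite S" "Poly_Mapping.keys f \<subseteq> S"
  shows "partial_deriv v f = (\<Sum>m\<in>S. Poly_Mapping.single (m - Poly_Mapping.single v 1)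
       (of_nat (Poly_Mapping.lookup m v) * Poly_Mapping.lookup f m))"
  unfolding partial_deriv_def using assms
  by (intro sum.mono_neutral_left) (auto simp: in_keys_iff)

lemma partial_deriv_single: "partial_deriv v (Poly_Mapping.single m c) =
    Poly_Mapping.single (m - Poly_Mapping.single v 1) (of_nat (Poly_Mapping.lookup m v) * c)"
  by (subst partial_deriv_superset[of "{m}"]) auto

lemma partial_deriv_add: "partial_deriv v (f + g) = partial_deriv v f + partial_deriv v g"
proof -
  let ?S = "Poly_Mapping.keys f \<union> Poly_Mapping.keys g"
  have "partial_deriv v (f + g) = (\<Sum>m\<in>?S. Poly_Mapping.single (m - Poly_Mapping.single v 1)
       (of_nat (Poly_Mapping.lookup m v) * Poly_Mapping.lookup (f + g) m))"
    by (rule partial_deriv_superset) (auto simp: Poly_Mapping.keys_add)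
  also have "\<dots> = partial_deriv v f + partial_deriv v g"
    by (simp add: partial_deriv_superset[of ?S] lookup_add distrib_left single_add sum.distrib)
  finally show ?thesis .
qed

lemma partial_deriv_mult:
  "partial_deriv v (f * g) = partial_deriv v f * g + f * partial_deriv v g"
proof (induction f rule: mpoly_induct)
  case (single a c)
  show ?case
  proof (induction g rule: mpoly_induct)
    case (single b d)
    let ?e = "Poly_Mapping.single v (1::nat)"
    \<comment> \<open>Exponent subtraction is truncated, so it commutes with adding
      \<open>m'\<close> only if \<open>v\<close> occurs in \<open>m\<close>. If \<open>v\<close>
      does not occur, the coefficient in \<open>1\<close> or \<open>2\<close> is zero and both sides
      vanish.\<close>
    have sub: "m - ?e + m' = m + m' - ?e" if "Poly_Mapping.lookup m v \<noteq> 0" for m m' :: monomial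
      using that by (intro poly_mapping_eqI) (auto simp: lookup_add lookup_minus lookup_single when_def)
    have 1: "Poly_Mapping.single (a - ?e + b) (of_nat (Poly_Mapping.lookup a v) * c * d)
        = Poly_Mapping.single (a + b - ?e) (of_nat (Poly_Mapping.lookup a v) * c * d)"
      by (cases "Poly_Mapping.lookup a v = 0") (simp, simp only: sub not_False_eq_True)
    have 2: "Poly_Mapping.single (a + (b - ?e)) (c * (of_nat (Poly_Mapping.lookup b v) * d))
        = Poly_Mapping.single (a + b - ?e) (c * (of_nat (Poly_Mapping.lookup b v) * d))"
      by (cases "Poly_Mapping.lookup b v = 0")
        (simp, simp only: sub[of b a] add.commute[of a] not_False_eq_True)
    show ?case
      unfolding mult_single partial_deriv_single 1 2 lookup_add
      by (simp add: algebra_simps flip: single_add)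
  qed (simp add: distrib_left partial_deriv_add)
qed (simp add: distrib_right partial_deriv_add)

lemma Delta_add: "Delta n (f + g) = Delta n f + Delta n g"
  by (simp add: Delta_def partial_deriv_add distrib_left sum.distrib)

lemma Delta_mult: "Delta n (f * g) = Delta n f * g + f * Delta n g"
  by (simp add: Delta_def partial_deriv_mult distrib_left sum.distrib sum_distrib_right
      sum_distrib_left mult.assoc mult.left_commute)

lemma Delta_pconst: "Delta n (pconst c) = 0"
  by (simp add: Delta_def pconst_def partial_deriv_single)

lemma Delta_0 [simp]: "Delta n 0 = 0"
  using Delta_pconst[of n 0] by (simp add: pconst_def)

lemma Delta_1 [simp]: "Delta n 1 = 0"
  using Delta_pconst[of n 1] by (simp add: pconst_def single_one)

lemma Delta_uminus: "Delta n (- f) = - Delta n f"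
  using Delta_add[of n "- f" f] by (simp add: eq_neg_iff_add_eq_0)

lemma Delta_diff: "Delta n (f - g) = Delta n f - Delta n g"
  using Delta_add[of n f "- g"] by (simp add: Delta_uminus)

lemma Delta_minor:
  "j \<in> {1..n} \<Longrightarrow> k \<in> {1..n} \<Longrightarrow> Delta n (minor j k) = (0 :: 'k::comm_ring_1 mpoly)"
  by (simp add: minor_def Delta_diff Delta_mult Delta_x Delta_y)

lemma Delta_power: "Delta n (f ^ Suc k) = of_nat (Suc k) * f ^ k * Delta n f"
  by (induction k) (simp_all add: Delta_mult algebra_simps)

section \<open>The DILL order on pairs of multisets\<close>

text \<open>Multisets in place of the lists of \<open>xu_monomial\<close> make the representation of
  a monomial unique, with multiplicities as exponents.\<close>

definition xu_mono :: "nat multiset \<Rightarrow> (nat \<times> nat) multiset \<Rightarrow> monomial" where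
  "xu_mono I E = (\<Sum>i\<in>#I. Poly_Mapping.single (X i) 1) + (\<Sum>(j, k)\<in>#E. Poly_Mapping.single (U j k) 1)"

lemma lookup_sum_mset:
  "Poly_Mapping.lookup (\<Sum>a\<in>#A. f a) v = (\<Sum>a\<in>#A. Poly_Mapping.lookup (f a) v)"
  by (induction A) (simp_all add: lookup_add)

lemma lookup_xu_mono [simp]:
  "Poly_Mapping.lookup (xu_mono I E) (X i) = count I i"
  "Poly_Mapping.lookup (xu_mono I E) (U j k) = count E (j, k)"
  "Poly_Mapping.lookup (xu_mono I E) (Y i) = 0"
proof -
  have 1: "(\<Sum>a\<in>#I. Poly_Mapping.lookup (Poly_Mapping.single (X a) (1::nat)) v)
      = (case v of X i \<Rightarrow> count I i | _ \<Rightarrow> 0)" for v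
    by (induction I) (auto simp: lookup_single when_def split: var.split)
  have 2: "(\<Sum>e\<in>#E. Poly_Mapping.lookup (case e of (j, k) \<Rightarrow> Poly_Mapping.single (U j k) (1::nat)) v)
      = (case v of U j k \<Rightarrow> count E (j, k) | _ \<Rightarrow> 0)" for v
    by (induction E) (auto simp: lookup_single when_def split: var.split if_splits)
  show "Poly_Mapping.lookup (xu_mono I E) (X i) = count I i"
    "Poly_Mapping.lookup (xu_mono I E) (U j k) = count E (j, k)"
    "Poly_Mapping.lookup (xu_mono I E) (Y i) = 0"
    by (simp_all only: xu_mono_def lookup_add lookup_sum_mset 1 2 var.case add_0_left add_0_right)
qed

lemma xu_mono_eq_iff [simp]: "xu_mono I E = xu_mono I' E' \<longleftrightarrow> I = I' \<and> E = E'"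
proof
  assume eq: "xu_mono I E = xu_mono I' E'"
  have "count I i = count I' i" for i
    using arg_cong[OF eq, of "\<lambda>m. Poly_Mapping.lookup m (X i)"] by simp
  moreover have "count E e = count E' e" for e
    using arg_cong[OF eq, of "\<lambda>m. Poly_Mapping.lookup m (U (fst e) (snd e))"] by simp
  ultimately show "I = I' \<and> E = E'" by (simp add: multiset_eqI)
qed simp

lemma xu_mono_add: "xu_mono I E + xu_mono I' E' = xu_mono (I + I') (E + E')"
  by (simp add: xu_mono_def add_ac)

lemma single_xu_mono_mult:
  "Poly_Mapping.single (xu_mono I E) c * Poly_Mapping.single (xu_mono I' E') d
    = Poly_Mapping.single (xu_mono (I + I') (E + E')) (c * d)"
  by (simp add: mult_single xu_mono_add)

lemma xv_eq_single: "xv i = Poly_Mapping.single (xu_mono {#i#} {#}) 1"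
  and uv_eq_single: "uv j k = Poly_Mapping.single (xu_mono {#} {#(j, k)#}) 1"
  by (simp_all add: pvar_def xu_mono_def)

definition all_products :: "nat \<Rightarrow> (nat multiset \<times> (nat \<times> nat) multiset) set" where
  "all_products n = {(I, E).
     (\<forall>i \<in># I. 1 \<le> i \<and> i \<le> n) \<and> (\<forall>(j, k) \<in># E. 1 \<le> j \<and> j < k \<and> k \<le> n)}"

lemma admissible_subset_all: "admissible_products n \<subseteq> all_products n"
  by (auto simp: admissible_products_def all_products_def)

lemma mem_XU [simp]:
  "X i \<in> XU n \<longleftrightarrow> 1 \<le> i \<and> i \<le> n"
  "U j k \<in> XU n \<longleftrightarrow> 1 \<le> j \<and> j < k \<and> k \<le> n"
  "Y i \<notin> XU n"
  by (auto simp: XU_def)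

lemma keys_xu_mono_subset_iff: "Poly_Mapping.keys (xu_mono I E) \<subseteq> XU n \<longleftrightarrow> (I, E) \<in> all_products n"
proof -
  have all_var: "(\<forall>v. P v) \<longleftrightarrow> (\<forall>i. P (X i)) \<and> (\<forall>i. P (Y i)) \<and> (\<forall>j k. P (U j k))" for P
    by (metis var.exhaust)
  show ?thesis
    unfolding subset_iff all_var by (auto simp: in_keys_iff all_products_def)
qed

lemma XU_monomialE:
  assumes "Poly_Mapping.keys m \<subseteq> XU n"
  obtains I E where "(I, E) \<in> all_products n" "m = xu_mono I E"
proof -
  \<comment> \<open>The multisets are read off the exponents. Pairs of the square that are no index
    of a variable have exponent 0 and contribute nothing.\<close>
  let ?I = "\<Sum>i\<in>{1..n}. replicate_mset (Poly_Mapping.lookup m (X i)) i"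
  let ?E = "\<Sum>e\<in>{1..n} \<times> {1..n}. replicate_mset (Poly_Mapping.lookup m (U (fst e) (snd e))) e"
  have out: "v \<notin> XU n \<Longrightarrow> Poly_Mapping.lookup m v = 0" for v
    using assms by (auto simp: in_keys_iff)
  have "m = xu_mono ?I ?E"
  proof (rule poly_mapping_eqI)
    fix v
    have "Poly_Mapping.lookup m (U j k) = 0" if "n < j" for j k
      using that by (intro out) simp
    then show "Poly_Mapping.lookup m v = Poly_Mapping.lookup (xu_mono ?I ?E) v"
      using out[of v]
      by (cases v) (auto simp: count_sum sum.delta not_le not_less Suc_le_eq)

  qed
  then show thesis
    using assms by (intro that[of ?I ?E]) (simp_all flip: keys_xu_mono_subset_iff)
qed

section \<open>The DILL order is a linear order\<close>

definition ilength :: "(nat \<times> nat) multiset \<Rightarrow> nat" where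
  "ilength E = (\<Sum>(j, k)\<in>#E. k - j)"

abbreviation tuple :: "nat multiset \<Rightarrow> (nat \<times> nat) multiset \<Rightarrow> nat list" where
  "tuple I E \<equiv> exponent_tuple (sorted_list_of_multiset I) (sorted_list_of_multiset E)"

abbreviation rank :: "nat multiset \<Rightarrow> (nat \<times> nat) multiset \<Rightarrow> nat \<times> nat \<times> nat" where
  "rank I E \<equiv> (size I, size E, ilength E)"

text \<open>The first three DILL criteria merge into one lexicographic comparison of
  \<open>rank\<close>; the fourth compares the tuples of the sorted lists.\<close>

definition dill_gt :: "nat multiset \<Rightarrow> (nat \<times> nat) multiset \<Rightarrow>
    nat multiset \<Rightarrow> (nat \<times> nat) multiset \<Rightarrow> bool" where
  "dill_gt I E I' E' \<longleftrightarrow> rank I' E' < rank I E \<or>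
     rank I' E' = rank I E \<and> (tuple I E, tuple I' E') \<in> lex less_than"

lemma standard_form_iff: "standard_form is us \<longleftrightarrow> sorted is \<and> sorted us"
proof -
  have "(\<lambda>(j, k) (j', k'). j < j' \<or> j = j' \<and> k \<le> k') = ((\<le>) :: nat \<times> nat \<Rightarrow> _)"
    by (auto simp: fun_eq_iff)
  then show ?thesis by (simp add: standard_form_def)
qed

lemma xu_monomial_eq_xu_mono: "xu_monomial is us = xu_mono (mset is) (mset us)"
  by (simp add: xu_monomial_def xu_mono_def split_def flip: sum_mset_sum_list)

lemma total_length_eq: "total_length us = ilength (mset us)"
  by (simp add: total_length_def ilength_def split_def flip: sum_mset_sum_list)

lemma sorted_list_of_multiset_of_sorted: "sorted xs \<Longrightarrow> sorted_list_of_multiset (mset xs) = xs"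
  by (simp add: sorted_sort_id)

lemma length_sorted_list_of_multiset: "length (sorted_list_of_multiset M) = size M"
  by (metis mset_sorted_list_of_multiset size_mset)

text \<open>Sorting a multiset yields its only standard form, so the existential quantifiers in
  \<open>dill_greater\<close> have forced witnesses.\<close>

lemma dill_greater_iff: "dill_greater (xu_mono I E) (xu_mono I' E') \<longleftrightarrow> dill_gt I E I' E'"
proof -
  have eq: "standard_form is us \<and> xu_mono I E = xu_monomial is us \<longleftrightarrow>
      is = sorted_list_of_multiset I \<and> us = sorted_list_of_multiset E" for I E "is" us
    unfolding standard_form_iff xu_monomial_eq_xu_mono xu_mono_eq_iff
    by (metis mset_sorted_list_of_multiset sorted_list_of_multiset_of_sorted
        sorted_sorted_list_of_multiset)
  have "dill_greater (xu_mono I E) (xu_mono I' E') \<longleftrightarrow> (\<exists>is us is' us'.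
     (standard_form is us \<and> xu_mono I E = xu_monomial is us) \<and>
     (standard_form is' us' \<and> xu_mono I' E' = xu_monomial is' us') \<and>
      dill_gt (mset is) (mset us) (mset is') (mset us'))"
    unfolding dill_greater_def dill_gt_def
    by (intro ex_cong1) (auto simp: standard_form_iff total_length_eq sorted_sort_id)
  then show ?thesis unfolding eq by simp
qed

lemma dill_gt_irrefl: "\<not> dill_gt I E I E"
  by (simp add: dill_gt_def lexord_lex lexord_irreflexive)

text \<open>\<open>lex\<close> is \<open>lexord\<close> restricted to lists of equal length and
  inherits transitivity from it.\<close>

lemma trans_lex_less_than: "trans (lex (less_than :: (nat \<times> nat) set))"
proof (rule transI)
  fix x y z :: "nat list"
  assume "(x, y) \<in> lex less_than" "(y, z) \<in> lex less_than"
  then show "(x, z) \<in> lex less_than"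
    using transD[OF lexord_transI[OF trans_less_than], of x y z] by (simp add: lexord_lex)
qed

lemma dill_gt_trans:
  assumes "dill_gt I E I' E'" "dill_gt I' E' I'' E''"
  shows "dill_gt I E I'' E''"
proof -
  have lex: "(tuple I E, tuple I'' E'') \<in> lex less_than"
    if "(tuple I E, tuple I' E') \<in> lex less_than" "(tuple I' E', tuple I'' E'') \<in> lex less_than"
    using transD[OF trans_lex_less_than that] .
  consider "rank I'' E'' < rank I' E'" "rank I' E' < rank I E"
    | "rank I'' E'' < rank I' E'" "rank I' E' = rank I E"
    | "rank I'' E'' = rank I' E'" "rank I' E' < rank I E"
    | "rank I'' E'' = rank I' E'" "rank I' E' = rank I E"
      "(tuple I E, tuple I' E') \<in> lex less_than" "(tuple I' E', tuple I'' E'') \<in> lex less_than"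
    using assms unfolding dill_gt_def by argo
  then show ?thesis
  proof cases
    case 1
    then have "rank I'' E'' < rank I E" by (rule less_trans)
    then show ?thesis unfolding dill_gt_def ..
  qed (unfold dill_gt_def, use lex in simp_all)
qed

text \<open>The sizes fix where the tuple splits into its three blocks, and zipping the last two
  restores the pairs.\<close>

lemma tuple_inject:
  assumes "tuple I E = tuple I' E'" "size I = size I'" "size E = size E'"
  shows "I = I' \<and> E = E'"
proof -
  have "sorted_list_of_multiset I = sorted_list_of_multiset I'"
    and "zip (map fst (sorted_list_of_multiset E)) (map snd (sorted_list_of_multiset E))
      = zip (map fst (sorted_list_of_multiset E')) (map snd (sorted_list_of_multiset E'))"
    using assms by (auto simp: exponent_tuple_def length_sorted_list_of_multiset)
  then show ?thesis
    by (metis mset_sorted_list_of_multiset zip_map_fst_snd)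
qed

lemma dill_gt_total: "I = I' \<and> E = E' \<or> dill_gt I E I' E' \<or> dill_gt I' E' I E"
proof -
  have "total (lexord (less_than :: (nat \<times> nat) set))"
    by (rule total_lexord) (auto simp: total_on_def)
  then have "tuple I E = tuple I' E' \<or> (tuple I E, tuple I' E') \<in> lexord less_than
      \<or> (tuple I' E', tuple I E) \<in> lexord less_than"
    unfolding total_on_def by blast
  then have lex: "tuple I E = tuple I' E' \<or> (tuple I E, tuple I' E') \<in> lexord less_than
      \<or> (tuple I' E', tuple I E) \<in> lexord less_than"
    unfolding total_on_def by blast
  show ?thesis
  proof (cases rule: linorder_cases[of "rank I' E'" "rank I E"])
    case equal
    then have sizes: "size I = size I'" "size E = size E'" by simp_all
    \<comment> \<open>Equal ranks force tuples of equal length, where totality of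
      \<open>lexord\<close> is totality of \<open>lex\<close>.\<close>
    then have "length (tuple I E) = length (tuple I' E')"
      by (simp add: exponent_tuple_def length_sorted_list_of_multiset)
    with lex tuple_inject[OF _ sizes]
    have "I = I' \<and> E = E' \<or> (tuple I E, tuple I' E') \<in> lex less_than
        \<or> (tuple I' E', tuple I E) \<in> lex less_than"
      unfolding lexord_lex by argo
    with equal show ?thesis unfolding dill_gt_def by argo
  qed (simp_all only: dill_gt_def simp_thms)
qed

section \<open>Compatibility of the DILL order with multiplication\<close>

lemma lex_append_iff:
  "length xs = length ys \<Longrightarrow> length xs' = length ys' \<Longrightarrow>
    (xs @ xs', ys @ ys') \<in> lex r \<longleftrightarrow> (xs, ys) \<in> lex r \<or> xs = ys \<and> (xs', ys') \<in> lex r"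
  by (induction xs ys rule: list_induct2) auto

text \<open>At the first difference \<open>x < y\<close>, either \<open>a\<close> enters both lists
  earlier or later on, or it comes between with \<open>x < a\<close> and \<open>a \<le> y\<close>;
  then \<open>x\<close> against \<open>a\<close> decides in the same sense.\<close>

lemma lex_insort:
  fixes xs ys :: "nat list"
  shows "length xs = length ys \<Longrightarrow> (xs, ys) \<in> lex less_than \<Longrightarrow>
    (insort a xs, insort a ys) \<in> lex less_than"
  by (induction xs ys rule: list_induct2) auto

text \<open>Since the first components agree, the comparisons of \<open>e\<close> with the two heads
  can differ only through the second components, and these behave as in
  \<open>lex_insort\<close>.\<close>

lemma lex_map_snd_insort:
  fixes us vs :: "(nat \<times> nat) list"
  shows "length us = length vs \<Longrightarrow> map fst us = map fst vs \<Longrightarrow>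
    (map snd us, map snd vs) \<in> lex less_than \<Longrightarrow>
    (map snd (insort e us), map snd (insort e vs)) \<in> lex less_than"
proof (induction us vs rule: list_induct2)
  case (Cons x xs y ys)
  then show ?case by (cases x; cases y; cases e) auto
qed simp

lemma sorted_map_fst: "sorted us \<Longrightarrow> sorted (map fst us)"
  for us :: "(nat \<times> nat) list"
  unfolding sorted_map by (rule sorted_wrt_mono_rel[of us "(\<le>)"]) (auto simp: less_eq_prod_def)

lemma map_fst_sorted_list_of_multiset:
  fixes E :: "(nat \<times> nat) multiset"
  shows "map fst (sorted_list_of_multiset E) = sorted_list_of_multiset (image_mset fst E)"
proof -
  have "sorted (map fst (sorted_list_of_multiset E))" by (intro sorted_map_fst) simp
  from sorted_list_of_multiset_of_sorted[OF this] show ?thesis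
    by (simp only: mset_map mset_sorted_list_of_multiset)
qed

text \<open>Separates the blocks so that the effect of one new factor can be followed. Left ends of
  a sorted list of pairs are themselves sorted and depend only on their multiset; right ends need
  not be sorted, so the third block stays a list.\<close>

lemma tuple_lex_iff:
  assumes "size I = size I'" "size E = size E'"
  shows "(tuple I E, tuple I' E') \<in> lex less_than \<longleftrightarrow>
    (sorted_list_of_multiset I, sorted_list_of_multiset I') \<in> lex less_than \<or>
    I = I' \<and> ((sorted_list_of_multiset (image_mset fst E),
                sorted_list_of_multiset (image_mset fst E')) \<in> lex less_than \<or>
      image_mset fst E = image_mset fst E' \<and>
      (map snd (sorted_list_of_multiset E), map snd (sorted_list_of_multiset E')) \<in> lex less_than)"
proof -
  have inj: "sorted_list_of_multiset M = sorted_list_of_multiset N \<longleftrightarrow> M = N"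
    for M N :: "nat multiset"
    using mset_sorted_list_of_multiset[of M] mset_sorted_list_of_multiset[of N] by metis
  show ?thesis
    using assms
    by (simp add: exponent_tuple_def lex_append_iff length_sorted_list_of_multiset
        map_fst_sorted_list_of_multiset inj)
qed

lemma dill_gt_add_mset_left:
  assumes "dill_gt I E I' E'"
  shows "dill_gt (add_mset i I) E (add_mset i I') E'"
proof (cases "rank I' E' = rank I E")
  case True
  then have sizes: "size I = size I'" "size E = size E'" by simp_all
  have "(tuple I E, tuple I' E') \<in> lex less_than" using assms True by (simp add: dill_gt_def)
  then have "(tuple (add_mset i I) E, tuple (add_mset i I') E') \<in> lex less_than"
    using sizes by (subst tuple_lex_iff) (auto simp: tuple_lex_iff lex_insort length_sorted_list_of_multiset)
  with True show ?thesis by (simp add: dill_gt_def)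
next
  case False
  with assms have "rank I' E' < rank I E" unfolding dill_gt_def by argo
  then show ?thesis by (simp add: dill_gt_def)
qed

lemma dill_gt_add_mset_right:
  assumes "dill_gt I E I' E'"
  shows "dill_gt I (add_mset e E) I' (add_mset e E')"
proof (cases "rank I' E' = rank I E")
  case True
  then have sizes: "size I = size I'" "size E = size E'" by simp_all
  have eq: "map fst (sorted_list_of_multiset E) = map fst (sorted_list_of_multiset E')"
    if "image_mset fst E = image_mset fst E'"
    using that by (simp add: map_fst_sorted_list_of_multiset)
  have "(tuple I E, tuple I' E') \<in> lex less_than" using assms True by (simp add: dill_gt_def)
  then have "(tuple I (add_mset e E), tuple I' (add_mset e E')) \<in> lex less_than"
    using sizes by (subst tuple_lex_iff) (auto simp: tuple_lex_iff lex_insort lex_map_snd_insort eq length_sorted_list_of_multiset)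
  with True show ?thesis by (simp add: dill_gt_def ilength_def)
next
  case False
  with assms have "rank I' E' < rank I E" unfolding dill_gt_def by argo
  then show ?thesis by (simp add: dill_gt_def ilength_def)
qed

lemma dill_gt_add:
  assumes "dill_gt I E I' E'"
  shows "dill_gt (I + I0) (E + E0) (I' + I0) (E' + E0)"
proof -
  have "dill_gt (I + I0) E (I' + I0) E'"
    by (induction I0) (use assms dill_gt_add_mset_left in simp_all)
  then show ?thesis
    by (induction E0) (use dill_gt_add_mset_right in simp_all)
qed

text \<open>The pair \<open>(i, j)\<close>, \<open>(k, l)\<close> is shorter by 2(k - j). The nested
  pair \<open>(i, l)\<close>, \<open>(j, k)\<close> has the same total length and the same left
  ends; there the right ends decide, by k < l.\<close>

lemma dill_gt_r:
  assumes "i < j" "j < k" "k < l"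
  shows "dill_gt {#} {#(i, k), (j, l)#} {#} {#(i, j), (k, l)#}"
    and "dill_gt {#} {#(i, k), (j, l)#} {#} {#(i, l), (j, k)#}"
  using assms by (auto simp: dill_gt_def ilength_def exponent_tuple_def)

text \<open>The interval \<open>(i, k)\<close> is strictly longer than each of its parts
  \<open>(i, j)\<close> and \<open>(j, k)\<close>.\<close>

lemma dill_gt_s:
  assumes "i < j" "j < k"
  shows "dill_gt {#j#} {#(i, k)#} {#i#} {#(j, k)#}"
    and "dill_gt {#j#} {#(i, k)#} {#k#} {#(i, j)#}"
  using assms by (auto simp: dill_gt_def ilength_def)

text \<open>The relations are homogeneous in the x-degree and in the u-degree, so rewriting stays
  inside this finite set. Counting its smaller elements gives a termination measure.\<close>

definition same_bidegree :: "nat \<Rightarrow> nat multiset \<Rightarrow> (nat \<times> nat) multiset \<Rightarrow>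
    (nat multiset \<times> (nat \<times> nat) multiset) set" where
  "same_bidegree n I E = {(I', E') \<in> all_products n. size I' = size I \<and> size E' = size E}"

lemma finite_same_bidegree: "finite (same_bidegree n I E)"
proof -
  have fin: "finite {M. set_mset M \<subseteq> S \<and> size M = k}" if "finite S" for S :: "'b set" and k
  proof (rule finite_subset)
    show "{M. set_mset M \<subseteq> S \<and> size M = k} \<subseteq> mset ` {xs. set xs \<subseteq> S \<and> length xs = k}"
    proof
      fix M assume "M \<in> {M. set_mset M \<subseteq> S \<and> size M = k}"
      moreover obtain xs where "M = mset xs" by (metis ex_mset)
      ultimately show "M \<in> mset ` {xs. set xs \<subseteq> S \<and> length xs = k}" by auto
    qed
  qed (use finite_lists_length_eq[OF that] in simp)
  have "same_bidegree n I E \<subseteq> {M. set_mset M \<subseteq> {1..n} \<and> size M = size I} \<times>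
      {M. set_mset M \<subseteq> {1..n} \<times> {1..n} \<and> size M = size E}"
    by (fastforce simp: same_bidegree_def all_products_def)
  then show ?thesis by (rule finite_subset) (simp add: fin)
qed

section \<open>Linear independence of the admissible products\<close>

lemma lookup_scale: "Poly_Mapping.lookup (scale c f) m = c * Poly_Mapping.lookup f m"
proof (induction f rule: mpoly_induct)
  case (add f g)
  have "scale c (f + g) = scale c f + scale c g" by (simp add: scale_def distrib_left)
  with add show ?case by (simp add: lookup_add distrib_left)
qed (simp add: scale_single lookup_single when_def)

section \<open>Strictly heaviest monomials\<close>

definition weight :: "nat \<Rightarrow> monomial \<Rightarrow> nat" where
  "weight n m = (\<Sum>i\<le>n. i * Poly_Mapping.lookup m (Y i))"

lemma weight_add: "weight n (a + b) = weight n a + weight n b"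
  by (simp add: weight_def lookup_add distrib_left sum.distrib)

lemma weight_X [simp]: "weight n (Poly_Mapping.single (X i) c) = 0"
  by (simp add: weight_def lookup_single)

lemma weight_Y [simp]: "i \<le> n \<Longrightarrow> weight n (Poly_Mapping.single (Y i) c) = i * c"
  by (simp add: weight_def lookup_single when_def if_distrib cong: if_cong)

text \<open>Distinct monomials may have equal weight, so not every polynomial has such a monomial;
  strictness is what makes it survive products.\<close>

definition leads :: "nat \<Rightarrow> 'k::field mpoly \<Rightarrow> monomial \<Rightarrow> bool" where
  "leads n f m \<longleftrightarrow> (\<exists>c f'. c \<noteq> 0 \<and> f = Poly_Mapping.single m c + f' \<and>
     (\<forall>m' \<in> Poly_Mapping.keys f'. weight n m' < weight n m))"

lemma leads_single: "c \<noteq> 0 \<Longrightarrow> leads n (Poly_Mapping.single m c) m"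
  unfolding leads_def by (rule exI[of _ c], rule exI[of _ 0]) simp

text \<open>Weights add under multiplication, so in the product every other pair of terms is lighter
  than the product of the two heaviest; its coefficient is nonzero over a field.\<close>

lemma leads_mult:
  assumes "leads n f a" "leads n g b"
  shows "leads n (f * g) (a + b)"
proof -
  obtain c f' d g' where *: "c \<noteq> 0" "f = Poly_Mapping.single a c + f'"
      "\<And>m. m \<in> Poly_Mapping.keys f' \<Longrightarrow> weight n m < weight n a"
      "d \<noteq> 0" "g = Poly_Mapping.single b d + g'"
      "\<And>m. m \<in> Poly_Mapping.keys g' \<Longrightarrow> weight n m < weight n b"
    using assms unfolding leads_def by blast
  let ?h = "Poly_Mapping.single a c * g' + (f' * Poly_Mapping.single b d + f' * g')"
  have eq: "f * g = Poly_Mapping.single (a + b) (c * d) + ?h"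
    using *(2,5) by (simp add: algebra_simps mult_single)
  have "weight n m < weight n (a + b)" if "m \<in> Poly_Mapping.keys ?h" for m
  proof -
    have "m \<in> Poly_Mapping.keys (Poly_Mapping.single a c * g') \<union>
        (Poly_Mapping.keys (f' * Poly_Mapping.single b d) \<union> Poly_Mapping.keys (f' * g'))"
      using that Poly_Mapping.keys_add[of "Poly_Mapping.single a c * g'" "f' * Poly_Mapping.single b d + f' * g'"]
        Poly_Mapping.keys_add[of "f' * Poly_Mapping.single b d" "f' * g'"] by blast
    then obtain p q where "m = p + q" "p = a \<and> q \<in> Poly_Mapping.keys g' \<or>
        p \<in> Poly_Mapping.keys f' \<and> (q = b \<or> q \<in> Poly_Mapping.keys g')"
      using keys_mult[of "Poly_Mapping.single a c" g'] keys_mult[of f' "Poly_Mapping.single b d"]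
        keys_mult[of f' g'] by (auto split: if_splits)
    then show ?thesis
      by (auto simp: weight_add dest!: *(3,6))
  qed
  then show ?thesis
    unfolding leads_def using eq *(1,4) by (intro exI[of _ "c * d"] exI[of _ ?h]) auto
qed

lemma leads_prod_mset:
  "(\<And>a. a \<in># A \<Longrightarrow> leads n (f a) (g a)) \<Longrightarrow> leads n (\<Prod>a\<in>#A. f a) (\<Sum>a\<in>#A. g a)"
  by (induction A) (auto simp: single_one[symmetric] simp del: single_one intro: leads_single leads_mult)

text \<open>Among the members with nonzero coefficient take \<open>Q\<close> with the heaviest
  \<open>g Q\<close>. No other member contributes to the coefficient at \<open>g Q\<close>: its own
  heaviest monomial differs by injectivity, and its remaining monomials are too light.\<close>

lemma leads_independent:
  assumes "finite S" "inj_on g S" "\<And>P. P \<in> S \<Longrightarrow> leads n (f P) (g P)"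
    and sum: "(\<Sum>P\<in>S. scale (c P) (f P)) = 0" and "P \<in> S"
  shows "c P = 0"
proof (rule ccontr)
  assume "c P \<noteq> 0"
  let ?T = "{P \<in> S. c P \<noteq> 0}"
  have "finite ?T" "?T \<noteq> {}" using assms \<open>c P \<noteq> 0\<close> by auto
  then obtain Q where Q: "Q \<in> ?T" "\<And>R. R \<in> ?T \<Longrightarrow> weight n (g R) \<le> weight n (g Q)"
    \<comment> \<open>Minimising the negated weight gives a maximum.\<close>
    using ex_is_arg_min_if_finite[of ?T "\<lambda>R. - int (weight n (g R))"]
    by (auto simp: is_arg_min_linorder)
  obtain d h where d: "d \<noteq> 0" "f Q = Poly_Mapping.single (g Q) d + h"
      "\<forall>m\<in>Poly_Mapping.keys h. weight n m < weight n (g Q)"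
    using assms(3)[of Q] Q(1) unfolding leads_def by auto
  have other: "c R * Poly_Mapping.lookup (f R) (g Q) = 0" if "R \<in> S - {Q}" for R
  proof (cases "c R = 0")
    case False
    have "R \<in> S" using that by simp
    from False have le: "weight n (g R) \<le> weight n (g Q)" and ne: "g R \<noteq> g Q"
      using that Q assms(2) by (auto simp: inj_on_def)
    obtain e h' where R: "f R = Poly_Mapping.single (g R) e + h'"
      "\<forall>m\<in>Poly_Mapping.keys h'. weight n m < weight n (g R)"
      using assms(3)[OF \<open>R \<in> S\<close>] unfolding leads_def by blast
    then have "g Q \<notin> Poly_Mapping.keys h'" using le by force
    with R ne show ?thesis
      by (simp add: lookup_add lookup_single when_def in_keys_iff)
  qed simp
  then have others: "(\<Sum>R\<in>S - {Q}. c R * Poly_Mapping.lookup (f R) (g Q)) = 0"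
    by (intro sum.neutral) blast
  have "0 = Poly_Mapping.lookup (\<Sum>P\<in>S. scale (c P) (f P)) (g Q)" using sum by simp
  also have "\<dots> = (\<Sum>R\<in>S. c R * Poly_Mapping.lookup (f R) (g Q))"
    by (simp add: lookup_sum lookup_scale)
  also have "\<dots> = c Q * Poly_Mapping.lookup (f Q) (g Q)"
    using Q(1) assms(1) others by (subst sum.remove[of S Q]) simp_all
  also have "Poly_Mapping.lookup (f Q) (g Q) = d"
    using d by (auto simp: lookup_add in_keys_iff)
  finally show False using Q(1) d(1) by simp
qed

section \<open>Recovering an admissible product from its heaviest monomial\<close>

definition lead_monomial :: "nat multiset \<Rightarrow> (nat \<times> nat) multiset \<Rightarrow> monomial" where
  "lead_monomial I E = (\<Sum>i\<in>#I. Poly_Mapping.single (X i) 1)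
     + (\<Sum>(j, k)\<in>#E. Poly_Mapping.single (X j) 1 + Poly_Mapping.single (Y k) 1)"

lemma minor_eq_single: "minor j k =
    Poly_Mapping.single (Poly_Mapping.single (X j) 1 + Poly_Mapping.single (Y k) 1) 1
    + Poly_Mapping.single (Poly_Mapping.single (X k) 1 + Poly_Mapping.single (Y j) 1) (-1)"
  by (simp add: minor_def pvar_def mult_single single_uminus)

text \<open>The two terms of the minor have weights \<open>k\<close> and \<open>j\<close>.\<close>

lemma leads_minor:
  assumes "j < k" "k \<le> n"
  shows "leads n (minor j k) (Poly_Mapping.single (X j) 1 + Poly_Mapping.single (Y k) 1)"
  unfolding leads_def minor_eq_single using assms
  by (intro exI[of _ 1] exI[of _ "Poly_Mapping.single
        (Poly_Mapping.single (X k) 1 + Poly_Mapping.single (Y j) 1) (-1)"]) (simp add: weight_add)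

lemma leads_generator_product:
  assumes "(I, E) \<in> all_products n"
  shows "leads n (generator_product (I, E) :: 'k::field mpoly) (lead_monomial I E)"
  unfolding generator_product_def prod.case lead_monomial_def
proof (intro leads_mult leads_prod_mset)
  fix e assume "e \<in># E"
  then show "leads n (case e of (j, k) \<Rightarrow> (minor j k :: 'k mpoly))
      (case e of (j, k) \<Rightarrow> Poly_Mapping.single (X j) 1 + Poly_Mapping.single (Y k) 1)"
    using assms by (cases e) (auto simp: all_products_def simp del: One_nat_def intro!: leads_minor)
qed (simp add: pvar_def leads_single)

lemma lookup_sum_mset_single:
  "(\<Sum>a\<in>#A. Poly_Mapping.lookup (Poly_Mapping.single (h a) (1::nat)) v)
    = count (image_mset h A) v"
  by (induction A) (auto simp: lookup_single when_def)

lemma count_image_mset_X: "count (image_mset (\<lambda>a. X (h a)) A) v =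
    (case v of X i \<Rightarrow> count (image_mset h A) i | _ \<Rightarrow> 0)"
  and count_image_mset_Y: "count (image_mset (\<lambda>a. Y (h a)) A) v =
    (case v of Y i \<Rightarrow> count (image_mset h A) i | _ \<Rightarrow> 0)"
  by (induction A; auto split: var.split)+

text \<open>What the monomial remembers: free factors x_i and left ends of arcs merged into one
  multiset, and the right ends.\<close>

lemma lookup_lead_monomial:
  "Poly_Mapping.lookup (lead_monomial I E) (X i) = count (I + image_mset fst E) i"
  "Poly_Mapping.lookup (lead_monomial I E) (Y i) = count (image_mset snd E) i"
  using count_image_mset_X[of "\<lambda>x. x" I] by (simp_all add: lead_monomial_def lookup_add
      lookup_sum_mset split_def sum_mset.distrib lookup_sum_mset_single[simplified]
      count_image_mset_X count_image_mset_Y)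

text \<open>The first closing bracket \<open>k\<close> is matched with the nearest opening bracket
  \<open>j\<close> before it. Some arc \<open>(i, k)\<close> ends at \<open>k\<close>, and i \<le>
  j. If i < j, then x_j cannot be a free factor, being covered by \<open>(i, k)\<close>; so
  \<open>j\<close> starts an arc \<open>(j, k')\<close> with k \<le> k', and not crossing
  \<open>(i, k)\<close> forces k' = k.\<close>

lemma admissible_arc_exists:
  assumes adm: "(I, E) \<in> admissible_products n" and "E \<noteq> {#}"
    and k: "k = Min (snd ` set_mset E)" and j: "j = Max {a. a \<in># I + image_mset fst E \<and> a < k}"
  shows "(j, k) \<in># E"
proof -
  let ?A = "{a. a \<in># I + image_mset fst E \<and> a < k}"
  have "k \<in> snd ` set_mset E" unfolding k using assms(2) by (intro Min_in) auto
  then obtain i where i: "(i, k) \<in># E" by auto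
  then have "i < k" using adm by (auto simp: admissible_products_def)
  with i have iA: "i \<in> ?A" by force
  have fin: "finite ?A" by simp
  then have jA: "j \<in> ?A" unfolding j using iA by (intro Max_in) auto
  have "i \<le> j" unfolding j using fin iA by (rule Max_ge)
  show ?thesis
  proof (cases "i = j")
    case True
    with i show ?thesis by simp
  next
    case False
    with \<open>i \<le> j\<close> have "i < j" by simp
    have "j \<notin># I"
      using adm i \<open>i < j\<close> jA by (force simp: admissible_products_def)
    then obtain k' where k': "(j, k') \<in># E" using jA by auto
    have "k \<le> k'" unfolding k using k' by (intro Min_le) force+
    moreover have "\<not> intersecting (i, k) (j, k')"
      using adm i k' unfolding admissible_products_def by blast
    ultimately have "k = k'" using \<open>i < j\<close> jA by auto
    with k' show ?thesis by simp
  qed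
qed

text \<open>The arc found by \<open>admissible_arc_exists\<close> is computed from the data that
  both products share, so it lies in both. Removing it preserves the hypotheses.\<close>

lemma admissible_unique:
  assumes "(I, E) \<in> admissible_products n" "(I', E') \<in> admissible_products n"
    and "I + image_mset fst E = I' + image_mset fst E'" "image_mset snd E = image_mset snd E'"
  shows "I = I' \<and> E = E'"
  using assms
proof (induction "size E" arbitrary: E E')
  case 0
  then show ?case by auto
next
  case (Suc s)
  have nz: "E \<noteq> {#}" "E' \<noteq> {#}" using Suc.hyps(2) Suc.prems(4) by auto
  let ?k = "Min (snd ` set_mset E)"
  let ?j = "Max {a. a \<in># I + image_mset fst E \<and> a < ?k}"
  have "snd ` set_mset E = snd ` set_mset E'"
    using arg_cong[OF Suc.prems(4), of set_mset] by simp
  then have mem: "(?j, ?k) \<in># E" "(?j, ?k) \<in># E'"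
    using admissible_arc_exists[OF Suc.prems(1) nz(1) refl refl]
      admissible_arc_exists[OF Suc.prems(2) nz(2) refl refl] Suc.prems(3) by auto
  then obtain F F' where F: "E = add_mset (?j, ?k) F" "E' = add_mset (?j, ?k) F'"
    by (meson multi_member_split)
  obtain e where e: "E = add_mset e F" "E' = add_mset e F'" using F by blast
  have "(I, F) \<in> admissible_products n" "(I', F') \<in> admissible_products n"
    using Suc.prems(1,2) unfolding e admissible_products_def by auto
  then have "I = I' \<and> F = F'"
    using Suc.hyps(1)[of F F'] Suc.hyps(2) Suc.prems(3,4) unfolding e by auto
  then show ?case using e by simp
qed

lemma inj_lead_monomial: "inj_on (\<lambda>(I, E). lead_monomial I E) (admissible_products n)"
proof (rule inj_onI)
  fix P Q assume PQ: "P \<in> admissible_products n" "Q \<in> admissible_products n"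
    and eq: "(\<lambda>(I, E). lead_monomial I E) P = (\<lambda>(I, E). lead_monomial I E) Q"
  obtain I E I' E' where [simp]: "P = (I, E)" "Q = (I', E')" by (metis surj_pair)
  have "I + image_mset fst E = I' + image_mset fst E'" "image_mset snd E = image_mset snd E'"
    using arg_cong[OF eq, of "\<lambda>m. Poly_Mapping.lookup m (X i)" for i]
      arg_cong[OF eq, of "\<lambda>m. Poly_Mapping.lookup m (Y i)" for i]
    by (auto simp: multiset_eq_iff lookup_lead_monomial)
  then show "P = Q" using admissible_unique PQ by auto
qed

theorem generator_product_independent:
  fixes c :: "_ \<Rightarrow> 'k::field"
  assumes "finite S" "S \<subseteq> admissible_products n"
    and "(\<Sum>P\<in>S. scale (c P) (generator_product P)) = 0" "P \<in> S"
  shows "c P = 0"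
proof (rule leads_independent[OF assms(1) _ _ assms(3,4)])
  show "inj_on (\<lambda>(I, E). lead_monomial I E) S"
    using inj_lead_monomial assms(2) by (rule inj_on_subset)
  fix Q assume "Q \<in> S"
  then show "leads n (generator_product Q) ((\<lambda>(I, E). lead_monomial I E) Q)"
    using assms(2) admissible_subset_all by (cases Q) (auto intro!: leads_generator_product)
qed

section \<open>Linear independence modulo \<open>x\<^sub>1\<close>\<close>

definition kill_x1 :: "var \<Rightarrow> 'k::comm_ring_1 mpoly" where
  "kill_x1 v = (if v = X 1 then 0 else pvar v)"

text \<open>Setting x_1 = 0 turns the minor of \<open>(1, k)\<close> into the single term -x_k y_1,
  so an arc from 1 leads with that monomial; the other minors are unchanged.\<close>

definition lead0 :: "nat \<times> nat \<Rightarrow> monomial" where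
  "lead0 = (\<lambda>(j, k). if j = 1 then Poly_Mapping.single (X k) 1 + Poly_Mapping.single (Y 1) 1
     else Poly_Mapping.single (X j) 1 + Poly_Mapping.single (Y k) 1)"

definition lead_monomial0 :: "nat multiset \<Rightarrow> (nat \<times> nat) multiset \<Rightarrow> monomial" where
  "lead_monomial0 I E = (\<Sum>i\<in>#I. Poly_Mapping.single (X i) 1) + (\<Sum>e\<in>#E. lead0 e)"

lemma leads_minor0:
  assumes "1 \<le> j" "j < k" "k \<le> n"
  shows "leads n (psubst kill_x1 (minor j k) :: 'k::field mpoly) (lead0 (j, k))"
proof (cases "j = 1")
  case True
  have "psubst kill_x1 (minor j k) = (- (xv k * yv 1) :: 'k mpoly)"
    using assms True by (simp add: minor_def psubst_diff psubst_mult psubst_pvar kill_x1_def)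
  also have "\<dots> = Poly_Mapping.single (lead0 (j, k)) (-1)"
    using True by (simp add: lead0_def pvar_def mult_single single_uminus)
  finally have "psubst kill_x1 (minor j k) = (Poly_Mapping.single (lead0 (j, k)) (-1) :: 'k mpoly)" .
  then show ?thesis by (simp add: leads_single)
next
  case False
  then have "psubst kill_x1 (minor j k) = (minor j k :: 'k mpoly)"
    using assms by (simp add: minor_def psubst_diff psubst_mult psubst_pvar kill_x1_def)
  then show ?thesis using False leads_minor[OF assms(2,3)] by (simp add: lead0_def)
qed

lemma leads_generator_product0:
  assumes "(I, E) \<in> all_products n" "1 \<notin># I"
  shows "leads n (psubst kill_x1 (generator_product (I, E)) :: 'k::field mpoly) (lead_monomial0 I E)"
  unfolding generator_product_def prod.case lead_monomial0_def psubst_mult psubst_prod_mset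
proof (intro leads_mult leads_prod_mset)
  fix e assume "e \<in># E"
  then show "leads n (psubst kill_x1 (case e of (j, k) \<Rightarrow> minor j k) :: 'k mpoly) (lead0 e)"
    using assms by (cases e) (auto simp: all_products_def simp del: One_nat_def intro!: leads_minor0)
next
  fix i assume "i \<in># I"
  then have "i \<noteq> 1" using assms(2) by auto
  then show "leads n (psubst kill_x1 (xv i) :: 'k mpoly) (Poly_Mapping.single (X i) 1)"
    unfolding psubst_pvar by (simp add: kill_x1_def leads_single pvar_def)
qed

lemma psubst_kill_x1_eq_0:
  "1 \<in># I \<Longrightarrow> psubst kill_x1 (generator_product (I, E)) = 0"
  by (auto simp: generator_product_def psubst_mult psubst_pvar kill_x1_def dest!: multi_member_split)

text \<open>Modulo x_1 an arc \<open>(1, k)\<close> looks like a free factor x_k accompanied by y_1.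
  Such arcs are therefore recorded by their right ends only.\<close>

definition from_1 :: "(nat \<times> nat) multiset \<Rightarrow> nat multiset" where
  "from_1 E = image_mset snd (filter_mset (\<lambda>e. fst e = 1) E)"

definition not_from_1 :: "(nat \<times> nat) multiset \<Rightarrow> (nat \<times> nat) multiset" where
  "not_from_1 E = filter_mset (\<lambda>e. fst e \<noteq> 1) E"

lemma from_1_decompose: "E = image_mset (Pair 1) (from_1 E) + not_from_1 E"
proof -
  have "image_mset (Pair 1) (from_1 E) = filter_mset (\<lambda>e. fst e = 1) E"
    unfolding from_1_def by (induction E) auto
  then show ?thesis unfolding not_from_1_def by (simp add: multiset_partition[symmetric])
qed

lemma lookup_lead_monomial0:
  "Poly_Mapping.lookup (lead_monomial0 I E) (X i)
    = count (I + from_1 E + image_mset fst (not_from_1 E)) i"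
  "Poly_Mapping.lookup (lead_monomial0 I E) (Y i)
    = (if i = 1 then size (from_1 E) else 0) + count (image_mset snd (not_from_1 E)) i"
proof -
  have 1: "(\<Sum>e\<in>#E. Poly_Mapping.lookup (lead0 e) (X i))
      = count (from_1 E) i + count (image_mset fst (not_from_1 E)) i"
    by (induction E) (auto simp: from_1_def not_from_1_def lead0_def lookup_add lookup_single when_def)
  have 2: "(\<Sum>e\<in>#E. Poly_Mapping.lookup (lead0 e) (Y i))
      = (if i = 1 then size (from_1 E) else 0) + count (image_mset snd (not_from_1 E)) i"
    by (induction E) (auto simp: from_1_def not_from_1_def lead0_def lookup_add lookup_single when_def)
  show "Poly_Mapping.lookup (lead_monomial0 I E) (X i)
      = count (I + from_1 E + image_mset fst (not_from_1 E)) i"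
    using count_image_mset_X[of "\<lambda>x. x" I]
    by (simp add: lead_monomial0_def lookup_add lookup_sum_mset 1 lookup_sum_mset_single[simplified])
  show "Poly_Mapping.lookup (lead_monomial0 I E) (Y i)
    = (if i = 1 then size (from_1 E) else 0) + count (image_mset snd (not_from_1 E)) i"
    using count_image_mset_X[of "\<lambda>x. x" I]
    by (simp add: lead_monomial0_def lookup_add lookup_sum_mset 2 lookup_sum_mset_single[simplified])
qed

text \<open>An arc that starts after 1 and covers \<open>k\<close> would cross the arc
  \<open>(1, k)\<close>; hence trading \<open>(1, k)\<close> for a free x_k creates no covered
  factor.\<close>

lemma admissible_move:
  assumes "(I, E) \<in> admissible_products n"
  shows "(I + from_1 E, not_from_1 E) \<in> admissible_products n"
proof -
  have mem_from: "k \<in># from_1 E \<longleftrightarrow> (1, k) \<in># E" for k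
    by (force simp: from_1_def)
  have sub: "e \<in># not_from_1 E \<longleftrightarrow> e \<in># E \<and> fst e \<noteq> 1" for e
    by (auto simp: not_from_1_def)
  have inter: "\<not> intersecting p q" if "p \<in># E" "q \<in># E" for p q
    using assms that by (simp add: admissible_products_def)
  have cover: "\<not> covers p i" if "p \<in># E" "i \<in># I" for p i
    using assms that by (simp add: admissible_products_def)
  have range: "1 \<le> j" "j < k" "k \<le> n" if "(j, k) \<in># E" for j k
    using assms that by (auto simp: admissible_products_def)
  have "\<not> covers p i" if p: "p \<in># not_from_1 E" and i: "i \<in># from_1 E" for p i
  proof (cases p)
    case (Pair j k)
    have "(j, k) \<in># E" "j \<noteq> 1" using p Pair by (auto simp: sub)
    then show ?thesis
      using inter[of "(1, i)" "(j, k)"] range[of j k] i Pair by (auto simp: mem_from)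
  qed
  moreover have "1 \<le> i \<and> i \<le> n" if "i \<in># I + from_1 E" for i
    using that assms range[of 1 i] by (auto simp: admissible_products_def mem_from)
  ultimately show ?thesis
    using inter cover range unfolding admissible_products_def by (auto simp: sub)
qed

text \<open>No arc from \<open>1\<close> covers an \<open>x\<^sub>i\<close>, so modulo \<open>x\<^sub>1\<close> the factors \<open>x\<^sub>k\<close> that come from such
  arcs are those with the smallest indices.\<close>

lemma smallest_part_unique:
  fixes K K' I I' :: "nat multiset"
  assumes "I + K = I' + K'" "size K = size K'"
    and "\<And>k i. k \<in># K \<Longrightarrow> i \<in># I \<Longrightarrow> k \<le> i" "\<And>k i. k \<in># K' \<Longrightarrow> i \<in># I' \<Longrightarrow> k \<le> i"
  shows "K = K'"
proof -
  have "sorted_list_of_multiset (I + K) = sorted_list_of_multiset K @ sorted_list_of_multiset I"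
    if "\<And>k i. k \<in># K \<Longrightarrow> i \<in># I \<Longrightarrow> k \<le> i" for I K :: "nat multiset"
  proof -
    have "sorted (sorted_list_of_multiset K @ sorted_list_of_multiset I)"
      using that by (auto simp: sorted_append)
    from sorted_list_of_multiset_of_sorted[OF this] show ?thesis by (simp add: add.commute)
  qed
  from this[of K I] this[of K' I'] have "sorted_list_of_multiset K = sorted_list_of_multiset K'"
    using assms by (auto simp: length_sorted_list_of_multiset)
  then show ?thesis by (metis mset_sorted_list_of_multiset)
qed

text \<open>The exponent of y_1 counts the arcs from 1. \<open>admissible_unique\<close>, applied
  after \<open>admissible_move\<close>, recovers the other arcs and the union of
  \<open>from_1 E\<close> with \<open>I\<close>; \<open>smallest_part_unique\<close> then separates
  this union.\<close>

lemma inj_lead_monomial0: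
  "inj_on (\<lambda>(I, E). lead_monomial0 I E) {P \<in> admissible_products n. 1 \<notin># fst P}"
proof (rule inj_onI)
  fix P Q assume "P \<in> {P \<in> admissible_products n. 1 \<notin># fst P}"
      "Q \<in> {P \<in> admissible_products n. 1 \<notin># fst P}"
  then have PQ: "P \<in> admissible_products n" "Q \<in> admissible_products n"
    and notin: "1 \<notin># fst P" "1 \<notin># fst Q" by simp_all
  assume eq: "(\<lambda>(I, E). lead_monomial0 I E) P = (\<lambda>(I, E). lead_monomial0 I E) Q"
  obtain I E I' E' where [simp]: "P = (I, E)" "Q = (I', E')" by (metis surj_pair)
  \<comment> \<open>Right ends exceed 1, so y_1 comes from arcs starting at 1 alone.\<close>
  have no1: "count (image_mset snd (not_from_1 F)) 1 = 0" if "(J, F) \<in> admissible_products n" for J F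
    using that by (fastforce simp: count_eq_zero_iff admissible_products_def not_from_1_def)
  have lookups: "Poly_Mapping.lookup (lead_monomial0 I E) v = Poly_Mapping.lookup (lead_monomial0 I' E') v" for v
    using eq by simp
  have size: "size (from_1 E) = size (from_1 E')"
    using lookups[of "Y 1"] no1 PQ unfolding lookup_lead_monomial0 by simp
  have "count (image_mset snd (not_from_1 E)) i = count (image_mset snd (not_from_1 E')) i" for i
    using lookups[of "Y i"] size unfolding lookup_lead_monomial0 by (simp split: if_splits)
  then have "image_mset snd (not_from_1 E) = image_mset snd (not_from_1 E')"
    by (rule multiset_eqI)
  moreover have "I + from_1 E + image_mset fst (not_from_1 E)
      = I' + from_1 E' + image_mset fst (not_from_1 E')"
    using lookups[of "X i" for i] unfolding lookup_lead_monomial0 by (rule multiset_eqI)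
  ultimately have *: "I + from_1 E = I' + from_1 E'" "not_from_1 E = not_from_1 E'"
    using admissible_unique[of "I + from_1 E" "not_from_1 E" n "I' + from_1 E'" "not_from_1 E'"]
      admissible_move PQ by simp_all
  \<comment> \<open>An arc \<open>(1, k)\<close> covers every index strictly between 1 and
    \<open>k\<close>, and index 1 is excluded from \<open>J\<close>.\<close>
  have le: "k \<le> i" if "(J, F) \<in> admissible_products n" "k \<in># from_1 F" "i \<in># J" "1 \<notin># J" for J F k i
  proof -
    have "(1, k) \<in># F" using that(2) by (force simp: from_1_def)
    with that(1,3) have "\<not> covers (1, k) i" "1 \<le> i" "1 < k"
      unfolding admissible_products_def by fast+
    moreover have "i \<noteq> 1" using that(3,4) by blast
    ultimately show ?thesis by auto
  qed
  have "from_1 E = from_1 E'"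
    using smallest_part_unique[OF *(1) size] le PQ notin by auto
  moreover from this have "E = E'"
    using from_1_decompose[of E] from_1_decompose[of E'] *(2) by simp
  ultimately show "P = Q" using *(1) by simp
qed

text \<open>Products containing x_1 vanish under \<open>kill_x1\<close>; the images of the others
  have distinct strictly heaviest monomials.\<close>

lemma independent_mod_x1:
  fixes c :: "_ \<Rightarrow> 'k::field"
  assumes "finite S" "S \<subseteq> admissible_products n"
    and sum: "psubst kill_x1 (\<Sum>P\<in>S. scale (c P) (generator_product P)) = 0"
    and P: "P \<in> S" "1 \<notin># fst P"
  shows "c P = 0"
proof -
  let ?T = "{P \<in> S. 1 \<notin># fst P}"
  have "0 = (\<Sum>P\<in>S. scale (c P) (psubst kill_x1 (generator_product P)))"
    using sum by (simp add: psubst_sum psubst_scale)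
  also have "\<dots> = (\<Sum>P\<in>?T. scale (c P) (psubst kill_x1 (generator_product P)))"
    using assms(1) by (intro sum.mono_neutral_right) (auto simp: psubst_kill_x1_eq_0 scale_def)
  finally have 0: "(\<Sum>P\<in>?T. scale (c P) (psubst kill_x1 (generator_product P))) = 0" by simp
  show ?thesis
  proof (rule leads_independent[OF _ _ _ 0])
    show "inj_on (\<lambda>(I, E). lead_monomial0 I E) ?T"
      using assms(2) by (intro inj_on_subset[OF inj_lead_monomial0]) auto
    fix Q assume "Q \<in> ?T"
    then show "leads n (psubst kill_x1 (generator_product Q)) ((\<lambda>(I, E). lead_monomial0 I E) Q)"
      using assms(2) admissible_subset_all by (cases Q) (auto intro!: leads_generator_product0 simp del: One_nat_def)
  qed (use assms in auto)
qed

section \<open>Rewriting modulo the relations\<close>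

text \<open>The parameter \<open>ty\<close> only fixes the coefficient field.\<close>

locale xu_ring =
  fixes n :: nat and ty :: "'k::field_char_0 itself"
begin

abbreviation R :: "'k mpoly ring" where "R \<equiv> poly_ring (XU n)"
abbreviation J :: "'k mpoly set" where "J \<equiv> rel_ideal n"

sublocale R: cring R
  by (rule cring_poly_ring)

lemma ops [simp]:
  "f \<otimes>\<^bsub>R\<^esub> g = f * g" "f \<oplus>\<^bsub>R\<^esub> g = f + g" "\<one>\<^bsub>R\<^esub> = 1" "\<zero>\<^bsub>R\<^esub> = 0"
  by (simp_all add: poly_ring_def)

lemma single_carrier: "Poly_Mapping.keys m \<subseteq> XU n \<Longrightarrow> Poly_Mapping.single m c \<in> carrier R"
  by (simp add: carrier_poly_ring)

lemma xu_mono_carrier: "(I, E) \<in> all_products n \<Longrightarrow> Poly_Mapping.single (xu_mono I E) c \<in> carrier R"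
  by (simp add: single_carrier keys_xu_mono_subset_iff)

lemma pvar_carrier: "v \<in> XU n \<Longrightarrow> pvar v \<in> carrier R"
  by (simp add: pvar_def single_carrier)

lemma uminus_carrier: "f \<in> carrier R \<Longrightarrow> - f \<in> carrier R"
  by (simp add: carrier_poly_ring)

lemma add_carrier: "f \<in> carrier R \<Longrightarrow> g \<in> carrier R \<Longrightarrow> f + g \<in> carrier R"
  and mult_carrier: "f \<in> carrier R \<Longrightarrow> g \<in> carrier R \<Longrightarrow> f * g \<in> carrier R"
  using R.a_closed[of f g] R.m_closed[of f g] by simp_all

lemma diff_carrier: "f \<in> carrier R \<Longrightarrow> g \<in> carrier R \<Longrightarrow> f - g \<in> carrier R"
  using add_carrier[of f "- g"] uminus_carrier by simp

lemma rels_carrier: "rels_R n \<union> rels_S n \<subseteq> carrier R"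
  unfolding rels_R_def rels_S_def rel_r_def rel_s_def
  by (auto intro!: add_carrier diff_carrier mult_carrier pvar_carrier)

lemma J_ideal: "ideal J R"
  unfolding rel_ideal_def by (rule R.genideal_ideal[OF rels_carrier])

lemma rels_in_J: "rels_R n \<union> rels_S n \<subseteq> J"
  unfolding rel_ideal_def by (rule R.genideal_self[OF rels_carrier])

lemma J_carrier: "f \<in> J \<Longrightarrow> f \<in> carrier R"
  using ideal.Icarr[OF J_ideal] .

lemma J_add: "f \<in> J \<Longrightarrow> g \<in> J \<Longrightarrow> f + g \<in> J"
  using additive_subgroup.a_closed[OF ideal.axioms(1)[OF J_ideal], of f g] by simp

lemma J_mult: "f \<in> J \<Longrightarrow> g \<in> carrier R \<Longrightarrow> g * f \<in> J"
  using ideal.I_l_closed[OF J_ideal, of f g] by simp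

lemma J_0: "0 \<in> J"
  using additive_subgroup.zero_closed[OF ideal.axioms(1)[OF J_ideal]] by simp

lemma J_scale: "f \<in> J \<Longrightarrow> scale c f \<in> J"
  unfolding scale_def pconst_def by (intro J_mult single_carrier) auto

lemma J_diff: "f \<in> J \<Longrightarrow> g \<in> J \<Longrightarrow> f - g \<in> J"
  using J_add[of f "scale (-1) g"] J_scale[of g "-1"]
  by (simp add: scale_def pconst_def single_uminus single_one)

lemma sum_in_J: "(\<And>a. a \<in> A \<Longrightarrow> f a \<in> J) \<Longrightarrow> sum f A \<in> J"
  by (induction A rule: infinite_finite_induct) (simp_all add: J_0 J_add)

text \<open>\<open>h\<close> is a remainder of the monomial \<open>xu_mono I E\<close> under division by the relations.\<close>

definition remainder :: "nat multiset \<Rightarrow> (nat \<times> nat) multiset \<Rightarrow> 'k mpoly \<Rightarrow> bool" where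
  "remainder I E h \<longleftrightarrow> Poly_Mapping.single (xu_mono I E) 1 - h \<in> J \<and>
     (\<forall>m \<in> Poly_Mapping.keys h. \<exists>(I', E') \<in> admissible_products n.
        m = xu_mono I' E' \<and> ((I', E') = (I, E) \<or> dill_gt I E I' E'))"

lemma remainder_step:
  assumes "Poly_Mapping.single (xu_mono I1 E1) 1 - Poly_Mapping.single (xu_mono I E) 1
      + Poly_Mapping.single (xu_mono I2 E2) 1 \<in> J"
    and gt: "dill_gt I E I1 E1" "dill_gt I E I2 E2"
    and rem: "remainder I1 E1 h1" "remainder I2 E2 h2"
  shows "remainder I E (h1 + h2)"
  unfolding remainder_def
proof (intro conjI ballI)
  let ?M = "\<lambda>I E. Poly_Mapping.single (xu_mono I E) (1::'k)"
  \<comment> \<open>Subtracting the relation cancels both smaller monomials and leaves the larger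
    one minus \<open>h1 + h2\<close>.\<close>
  have "(?M I1 E1 - h1) + (?M I2 E2 - h2) - (?M I1 E1 - ?M I E + ?M I2 E2) \<in> J"
    using J_diff[OF J_add[of "?M I1 E1 - h1" "?M I2 E2 - h2"] assms(1)] rem
    by (simp add: remainder_def)
  then show "?M I E - (h1 + h2) \<in> J" by (simp add: algebra_simps)
next
  fix m assume "m \<in> Poly_Mapping.keys (h1 + h2)"
  then have "m \<in> Poly_Mapping.keys h1 \<or> m \<in> Poly_Mapping.keys h2"
    using Poly_Mapping.keys_add[of h1 h2] by blast
  then obtain I' E' where "(I', E') \<in> admissible_products n" "m = xu_mono I' E'"
      "(I', E') = (I1, E1) \<or> dill_gt I1 E1 I' E' \<or> (I', E') = (I2, E2) \<or> dill_gt I2 E2 I' E'"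
    using rem unfolding remainder_def by fast
  then show "\<exists>(I', E')\<in>admissible_products n. m = xu_mono I' E' \<and> ((I', E') = (I, E) \<or> dill_gt I E I' E')"
    using gt dill_gt_trans by blast
qed

text \<open>The relation \<open>rel_r i j k l\<close> multiplied by the cofactor
  \<open>xu_mono I E\<close>.\<close>

lemma rewrite_r:
  assumes "(I, add_mset (i, k) (add_mset (j, l) E)) \<in> all_products n" "i < j" "j < k" "k < l"
  shows "Poly_Mapping.single (xu_mono I (add_mset (i, j) (add_mset (k, l) E))) 1
    - Poly_Mapping.single (xu_mono I (add_mset (i, k) (add_mset (j, l) E))) 1
    + Poly_Mapping.single (xu_mono I (add_mset (i, l) (add_mset (j, k) E))) 1 \<in> J"
proof -
  have "(I, E) \<in> all_products n" and "1 \<le> i" "l \<le> n"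
    using assms(1) by (auto simp: all_products_def)
  then have "rel_r i j k l \<in> rels_R n"
    using assms unfolding rels_R_def by blast
  then have "rel_r i j k l \<in> J" using rels_in_J by blast
  with \<open>(I, E) \<in> all_products n\<close> have "Poly_Mapping.single (xu_mono I E) 1 * rel_r i j k l \<in> J"
    by (intro J_mult xu_mono_carrier)
  then show ?thesis
    by (simp add: rel_r_def uv_eq_single single_xu_mono_mult algebra_simps add_mset_commute)
qed

lemma rewrite_s:
  assumes "(add_mset j I, add_mset (i, k) E) \<in> all_products n" "i < j" "j < k"
  shows "Poly_Mapping.single (xu_mono (add_mset i I) (add_mset (j, k) E)) 1
    - Poly_Mapping.single (xu_mono (add_mset j I) (add_mset (i, k) E)) 1
    + Poly_Mapping.single (xu_mono (add_mset k I) (add_mset (i, j) E)) 1 \<in> J"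
proof -
  have "(I, E) \<in> all_products n" and "1 \<le> i" "k \<le> n"
    using assms(1) by (auto simp: all_products_def)
  then have "rel_s i j k \<in> rels_S n"
    using assms unfolding rels_S_def by blast
  then have "rel_s i j k \<in> J" using rels_in_J by blast
  with \<open>(I, E) \<in> all_products n\<close> have "Poly_Mapping.single (xu_mono I E) 1 * rel_s i j k \<in> J"
    by (intro J_mult xu_mono_carrier)
  then show ?thesis
    by (simp add: rel_s_def uv_eq_single xv_eq_single single_xu_mono_mult algebra_simps)
qed

text \<open>A product that is not admissible contains the leading monomial of some relation: a
  crossing pair for \<open>rel_r\<close>, a covered factor for \<open>rel_s\<close>. This drives
  both the rewriting and the divisibility in \<open>groebner\<close>.\<close>

lemma not_admissible_cases:
  assumes "(I, E) \<in> all_products n" "(I, E) \<notin> admissible_products n"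
  obtains (r) i j k l E0 where "i < j" "j < k" "k < l" "E = add_mset (i, k) (add_mset (j, l) E0)"
    | (s) i j k I0 E0 where "i < j" "j < k" "I = add_mset j I0" "E = add_mset (i, k) E0"
proof -
  consider (int) p q where "p \<in># E" "q \<in># E" "intersecting p q"
    | (cov) p i where "p \<in># E" "i \<in># I" "covers p i"
    using assms unfolding admissible_products_def all_products_def by blast
  then show thesis
  proof cases
    case int
    obtain a b c d where pq: "p = (a, b)" "q = (c, d)" by (metis surj_pair)
    obtain i j k l where ijkl: "(i, k) \<in># E" "(j, l) \<in># E" "i < j" "j < k" "k < l"
      using int unfolding pq by auto
    then obtain E1 where E1: "E = add_mset (i, k) E1" by (meson multi_member_split)
    \<comment> \<open>The two crossing arcs differ, so removing the first keeps the second.\<close>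
    with ijkl have "(j, l) \<in># E1" by auto
    then obtain E0 where "E1 = add_mset (j, l) E0" by (meson multi_member_split)
    with E1 ijkl r show thesis by blast
  next
    case cov
    obtain a b where p: "p = (a, b)" by fastforce
    obtain I0 E0 where "E = add_mset (a, b) E0" "I = add_mset i I0"
      using cov p by (meson multi_member_split)
    with cov p s show thesis by auto
  qed
qed

text \<open>Induction on the number of DILL-smaller products of the same bidegree. A rewriting step
  keeps the bidegree, so by transitivity these sets shrink; the shrinking is strict because the new
  product has left its own set.\<close>

lemma remainder_exists:
  assumes "(I, E) \<in> all_products n"
  shows "\<exists>h. remainder I E h"
  using assms
proof (induction "card {(I', E') \<in> same_bidegree n I E. dill_gt I E I' E'}" arbitrary: I E rule: less_induct)
  case less
  have smaller: "\<exists>h. remainder I' E' h"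
    if "dill_gt I E I' E'" "(I', E') \<in> all_products n" "size I' = size I" "size E' = size E" for I' E'
  proof (rule less.hyps[OF psubset_card_mono])
    have eq: "same_bidegree n I' E' = same_bidegree n I E"
      using that by (simp add: same_bidegree_def)
    show "finite {(I', E') \<in> same_bidegree n I E. dill_gt I E I' E'}"
      by (rule finite_subset[OF _ finite_same_bidegree[of n I E]]) auto
    have "(I', E') \<in> same_bidegree n I E" using that by (simp add: same_bidegree_def)
    then show "{(I'', E'') \<in> same_bidegree n I' E'. dill_gt I' E' I'' E''}
        \<subset> {(I', E') \<in> same_bidegree n I E. dill_gt I E I' E'}"
      unfolding eq using that(1) dill_gt_trans dill_gt_irrefl by fast
  qed (use that in simp)
  show ?case
  proof (cases "(I, E) \<in> admissible_products n")
    case True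
    then have "remainder I E (Poly_Mapping.single (xu_mono I E) 1)"
      using J_0 by (auto simp: remainder_def)
    then show ?thesis ..
  next
    case False
    with less.prems show ?thesis
    proof (cases rule: not_admissible_cases)
      case (r i j k l E0)
      let ?E1 = "add_mset (i, j) (add_mset (k, l) E0)" and ?E2 = "add_mset (i, l) (add_mset (j, k) E0)"
      have gt: "dill_gt I E I ?E1" "dill_gt I E I ?E2"
        using dill_gt_add[OF dill_gt_r(1)[OF r(1-3)], of I E0] dill_gt_add[OF dill_gt_r(2)[OF r(1-3)], of I E0] r(4)
        by simp_all
      have "(I, ?E1) \<in> all_products n" "(I, ?E2) \<in> all_products n"
        using less.prems r by (auto simp: all_products_def)
      then obtain h1 h2 where h: "remainder I ?E1 h1" "remainder I ?E2 h2"
        using smaller gt r(4) by fastforce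
      then show ?thesis
        using remainder_step[OF _ gt h] rewrite_r[of I i k j l E0] less.prems r by blast
    next
      case (s i j k I0 E0)
      let ?I1 = "add_mset i I0" and ?E1 = "add_mset (j, k) E0"
      let ?I2 = "add_mset k I0" and ?E2 = "add_mset (i, j) E0"
      have gt: "dill_gt I E ?I1 ?E1" "dill_gt I E ?I2 ?E2"
        using dill_gt_add[OF dill_gt_s(1)[OF s(1-2)], of I0 E0] dill_gt_add[OF dill_gt_s(2)[OF s(1-2)], of I0 E0] s(3,4)
        by simp_all
      have "(?I1, ?E1) \<in> all_products n" "(?I2, ?E2) \<in> all_products n"
        using less.prems s by (auto simp: all_products_def)
      then obtain h1 h2 where h: "remainder ?I1 ?E1 h1" "remainder ?I2 ?E2 h2"
        using smaller gt s(3,4) by fastforce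
      then show ?thesis
        using remainder_step[OF _ gt h] rewrite_s[of j I0 i k E0] less.prems s by blast
    qed
  qed
qed

definition reduced :: "'k mpoly \<Rightarrow> bool" where
  "reduced h \<longleftrightarrow> Poly_Mapping.keys h \<subseteq> (\<lambda>(I, E). xu_mono I E) ` admissible_products n"

text \<open>Remainders of the monomials of \<open>f\<close> are combined linearly. The third
  conclusion bounds each monomial of \<open>h\<close> by one of \<open>f\<close>; it is the input
  for \<open>groebner\<close>.\<close>

lemma remainder_poly_exists:
  assumes "f \<in> carrier R"
  obtains h where "f - h \<in> J" "reduced h"
    "\<And>I' E'. xu_mono I' E' \<in> Poly_Mapping.keys h \<Longrightarrow>
      \<exists>I E. xu_mono I E \<in> Poly_Mapping.keys f \<and> (I' = I \<and> E' = E \<or> dill_gt I E I' E')"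
proof -
  have "\<exists>h. \<forall>I E. m = xu_mono I E \<longrightarrow> remainder I E h" if m: "m \<in> Poly_Mapping.keys f" for m
  proof -
    have "Poly_Mapping.keys m \<subseteq> XU n" using m assms by (auto simp: carrier_poly_ring)
    then obtain I E where "(I, E) \<in> all_products n" "m = xu_mono I E" by (rule XU_monomialE)
    with remainder_exists[of I E] show ?thesis by simp
  qed
  then have "\<forall>m\<in>Poly_Mapping.keys f. \<exists>h. \<forall>I E. m = xu_mono I E \<longrightarrow> remainder I E h" ..
  from bchoice[OF this]
  obtain H where H0: "\<forall>m\<in>Poly_Mapping.keys f. \<forall>I E. m = xu_mono I E \<longrightarrow> remainder I E (H m)" ..
  have H: "remainder I E (H (xu_mono I E))" if "xu_mono I E \<in> Poly_Mapping.keys f" for I E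
    using H0[rule_format, OF that refl] .
  have xu_mono: "\<exists>I E. m = xu_mono I E" if "m \<in> Poly_Mapping.keys f" for m
  proof -
    have "Poly_Mapping.keys m \<subseteq> XU n" using that assms by (auto simp: carrier_poly_ring)
    then show ?thesis by (rule XU_monomialE) blast
  qed
  let ?h = "\<Sum>m\<in>Poly_Mapping.keys f. scale (Poly_Mapping.lookup f m) (H m)"
  have keys: "\<exists>I E I' E'. xu_mono I E \<in> Poly_Mapping.keys f \<and> m = xu_mono I' E' \<and>
      (I', E') \<in> admissible_products n \<and> ((I', E') = (I, E) \<or> dill_gt I E I' E')"
    if m: "m \<in> Poly_Mapping.keys ?h" for m
  proof -
    have "(\<Sum>m'\<in>Poly_Mapping.keys f. Poly_Mapping.lookup f m' * Poly_Mapping.lookup (H m') m) \<noteq> 0"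
      using m by (simp add: in_keys_iff lookup_sum lookup_scale)
    \<comment> \<open>A monomial of the sum must occur in the remainder of at least one monomial of
      \<open>f\<close>.\<close>
    then obtain m' where m': "m' \<in> Poly_Mapping.keys f" "Poly_Mapping.lookup (H m') m \<noteq> 0"
      by (rule sum.not_neutral_contains_not_neutral) (rule that, assumption, auto)
    then obtain I E where "m' = xu_mono I E" using xu_mono by blast
    with m' H[of I E] have "remainder I E (H m')" "m \<in> Poly_Mapping.keys (H m')"
      by (simp_all add: in_keys_iff)
    from this have "\<exists>(I', E')\<in>admissible_products n. m = xu_mono I' E' \<and> ((I', E') = (I, E) \<or> dill_gt I E I' E')"
      unfolding remainder_def by (elim conjE bspec)
    then show ?thesis using m'(1) unfolding \<open>m' = xu_mono I E\<close> by blast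
  qed
  show thesis
  proof
    have "f - ?h = (\<Sum>m\<in>Poly_Mapping.keys f. scale (Poly_Mapping.lookup f m) (Poly_Mapping.single m 1 - H m))"
      by (subst mpoly_expand[of f])
        (simp add: scale_single mp.scale_right_diff_distrib sum_subtractf)
    also have "\<dots> \<in> J"
    proof (rule sum_in_J)
      fix m assume m: "m \<in> Poly_Mapping.keys f"
      then obtain I E where "m = xu_mono I E" using xu_mono by blast
      with m H[of I E] show "scale (Poly_Mapping.lookup f m) (Poly_Mapping.single m 1 - H m) \<in> J"
        by (intro J_scale) (simp add: remainder_def)
    qed
    finally show "f - ?h \<in> J" .
    show "reduced ?h"
      unfolding reduced_def using keys by fast
    fix I' E' assume "xu_mono I' E' \<in> Poly_Mapping.keys ?h"
    from keys[OF this] show "\<exists>I E. xu_mono I E \<in> Poly_Mapping.keys f \<and> (I' = I \<and> E' = E \<or> dill_gt I E I' E')"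
      unfolding xu_mono_eq_iff by blast
  qed
qed

end

section \<open>The presentation map\<close>

lemma psubst_single_xu_mono:
  "psubst generator (Poly_Mapping.single (xu_mono I E) 1) = (generator_product (I, E) :: 'k::comm_ring_1 mpoly)"
proof -
  have mv: "mono_value \<sigma> (\<Sum>a\<in>#A. f a) = (\<Prod>a\<in>#A. mono_value \<sigma> (f a))" for \<sigma> A and f :: "'a \<Rightarrow> monomial"
    by (induction A) (simp_all add: mono_value_add)
  show ?thesis
    by (simp add: psubst_single scale_def pconst_def single_one xu_mono_def mono_value_add mv
        mono_value_single generator_product_def split_def del: One_nat_def)
qed

text \<open>The Pluecker relation for the 2 by 2 minors of the matrix with rows x and y.\<close>

lemma presentation_map_rel_r: "presentation_map (rel_r i j k l) = 0"
  by (simp add: presentation_map_def rel_r_def psubst_add psubst_diff psubst_mult psubst_pvar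
      minor_def algebra_simps)

text \<open>The expansion of a 3 by 3 determinant with rows x, x, y along its first row.\<close>

lemma presentation_map_rel_s: "presentation_map (rel_s i j k) = 0"
  by (simp add: presentation_map_def rel_s_def psubst_add psubst_diff psubst_mult psubst_pvar
      minor_def algebra_simps)

lemma carrier_constants_ring:
  "f \<in> carrier (constants_ring n) \<longleftrightarrow> f \<in> carrier (poly_ring (XY n)) \<and> Delta n f = 0"
  by (simp add: constants_ring_def)

lemma poly_ring_closed:
  assumes "f \<in> carrier (poly_ring V)" "g \<in> carrier (poly_ring V)"
  shows "f + g \<in> carrier (poly_ring V)" "f * g \<in> carrier (poly_ring V)" "f - g \<in> carrier (poly_ring V)"
    "scale c f \<in> carrier (poly_ring V)"
proof -
  interpret R: cring "poly_ring V :: 'a mpoly ring" by (rule cring_poly_ring)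
  have mult: "f * g \<in> carrier (poly_ring V)" if "f \<in> carrier (poly_ring V)" "g \<in> carrier (poly_ring V)"
    for f g :: "'a mpoly"
    using R.m_closed[OF that] by (simp add: poly_ring_def)
  have add: "f + g \<in> carrier (poly_ring V)" if "f \<in> carrier (poly_ring V)" "g \<in> carrier (poly_ring V)"
    for f g :: "'a mpoly"
    using R.a_closed[OF that] by (simp add: poly_ring_def)
  show "f + g \<in> carrier (poly_ring V)" "f * g \<in> carrier (poly_ring V)"
    using add[OF assms] mult[OF assms] .
  have "- g \<in> carrier (poly_ring V)" using assms(2) unfolding carrier_poly_ring keys_minus .
  from add[OF assms(1) this] show "f - g \<in> carrier (poly_ring V)" by simp
  have "pconst c \<in> carrier (poly_ring V)" by (simp add: carrier_poly_ring pconst_def)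
  from mult[OF this assms(1)] show "scale c f \<in> carrier (poly_ring V)" unfolding scale_def .
qed

text \<open>Constants and the variables in \<open>V\<close> generate the ring: each term is a
  constant times a product of powers of variables.\<close>

lemma carrier_poly_ring_induct [consumes 1, case_names const var add mult]:
  fixes f :: "'k::comm_ring_1 mpoly"
  assumes "f \<in> carrier (poly_ring V)"
    and const: "\<And>c. P (pconst c)" and var: "\<And>v. v \<in> V \<Longrightarrow> P (pvar v)"
    and add: "\<And>f g. P f \<Longrightarrow> P g \<Longrightarrow> P (f + g)" and mult: "\<And>f g. P f \<Longrightarrow> P g \<Longrightarrow> P (f * g)"
  shows "P f"
proof -
  have one: "P 1" using const[of 1] by (simp add: pconst_def single_one)
  have pow: "P (g ^ k)" if "P g" for g k by (induction k) (simp_all add: one mult that)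
  have prod: "P (prod g A)" if "\<And>a. a \<in> A \<Longrightarrow> P (g a)" for g :: "var \<Rightarrow> _" and A
    using that by (induction A rule: infinite_finite_induct) (simp_all add: one mult)
  have zero: "P 0" using const[of 0] by (simp add: pconst_def)
  have sum: "P (sum g A)" if "\<And>a. a \<in> A \<Longrightarrow> P (g a)" for g :: "monomial \<Rightarrow> _" and A
    using that by (induction A rule: infinite_finite_induct) (simp_all add: zero add)
  have mono: "P (Poly_Mapping.single m c)" if "Poly_Mapping.keys m \<subseteq> V" for m c
  proof -
    have "Poly_Mapping.single m c = pconst c * mono_value pvar m"
      unfolding mono_value_eq_monomial pconst_def mult_single by simp
    also have "P \<dots>"
      unfolding mono_value_def using that by (intro mult[OF const] prod pow var) blast
    finally show ?thesis .
  qed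
  show ?thesis
  proof (subst mpoly_expand[of f], rule sum)
    fix m assume "m \<in> Poly_Mapping.keys f"
    with assms(1) have "Poly_Mapping.keys m \<subseteq> V" unfolding carrier_poly_ring by blast
    then show "P (Poly_Mapping.single m (Poly_Mapping.lookup f m))" by (rule mono)
  qed
qed

context xu_ring
begin

definition A :: "'k mpoly set" where
  "A = mp.span (generator_product ` admissible_products n)"

lemma presentation_map_J:
  assumes "f \<in> J"
  shows "presentation_map f = 0"
proof -
  \<comment> \<open>The kernel is an ideal containing the generators, hence contains the smallest
    such ideal \<open>J\<close>.\<close>
  have "ideal {f \<in> carrier R. presentation_map f = 0} R"
  proof (rule idealI[OF R.ring_axioms])
    show "subgroup {f \<in> carrier R. presentation_map f = 0} (add_monoid R)"
    proof (rule group.subgroupI)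
      show "group (add_monoid R)" using R.a_comm_group by (rule comm_group.axioms)
      fix a assume a: "a \<in> {f \<in> carrier R. presentation_map f = 0}"
      then have "inv\<^bsub>add_monoid R\<^esub> a = - a"
        using R.minus_equality[of "- a" a] uminus_carrier by (simp add: a_inv_def)
      then show "inv\<^bsub>add_monoid R\<^esub> a \<in> {f \<in> carrier R. presentation_map f = 0}"
        using a uminus_carrier by (simp add: presentation_map_def psubst_uminus)
    qed (use J_0 J_carrier add_carrier in \<open>auto simp: presentation_map_def psubst_add\<close>)
  qed (use mult_carrier in \<open>auto simp: presentation_map_def psubst_mult\<close>)
  moreover have "rels_R n \<union> rels_S n \<subseteq> {f \<in> carrier R. presentation_map f = 0}"
  proof
    fix f :: "'k mpoly" assume "f \<in> rels_R n \<union> rels_S n"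
    moreover from this have "presentation_map f = 0"
      by (auto simp: rels_R_def rels_S_def presentation_map_rel_r presentation_map_rel_s)
    ultimately show "f \<in> {f \<in> carrier R. presentation_map f = 0}" using rels_carrier by blast
  qed
  ultimately have "J \<subseteq> {f \<in> carrier R. presentation_map f = 0}"
    unfolding rel_ideal_def by (rule R.genideal_minimal)
  with assms show ?thesis by auto
qed

lemma presentation_map_single_xu_mono:
  "presentation_map (Poly_Mapping.single (xu_mono I E) c) = scale (c::'k) (generator_product (I, E))"
proof -
  have "Poly_Mapping.single (xu_mono I E) c = scale c (Poly_Mapping.single (xu_mono I E) (1::'k))"
    by (simp add: scale_single)
  then show ?thesis
    by (simp only: presentation_map_def psubst_scale psubst_single_xu_mono)
qed

lemma presentation_map_reduced:
  assumes "reduced h"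
  shows "presentation_map h = (\<Sum>(I, E)\<in>{(I, E). xu_mono I E \<in> Poly_Mapping.keys h}.
    scale (Poly_Mapping.lookup h (xu_mono I E)) (generator_product (I, E)))"
proof -
  have bij: "bij_betw (\<lambda>(I, E). xu_mono I E) {(I, E). xu_mono I E \<in> Poly_Mapping.keys h} (Poly_Mapping.keys h)"
    using assms by (force simp: bij_betw_def inj_on_def reduced_def)
  have "presentation_map h = (\<Sum>m\<in>Poly_Mapping.keys h.
      presentation_map (Poly_Mapping.single m (Poly_Mapping.lookup h m)))"
    by (subst mpoly_expand[of h]) (simp add: presentation_map_def psubst_sum)
  also have "\<dots> = (\<Sum>(I, E)\<in>{(I, E). xu_mono I E \<in> Poly_Mapping.keys h}.
      presentation_map (Poly_Mapping.single (xu_mono I E) (Poly_Mapping.lookup h (xu_mono I E))))"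
    by (subst sum.reindex_bij_betw[OF bij, symmetric]) (simp add: split_def)
  finally show ?thesis by (simp add: presentation_map_single_xu_mono)
qed

lemma presentation_map_reduced_in_A: "reduced h \<Longrightarrow> presentation_map h \<in> A"
  unfolding A_def presentation_map_reduced
  by (intro mp.span_sum) (auto simp: reduced_def intro!: mp.span_scale[OF mp.span_base])

text \<open>The coefficients of \<open>h\<close> are those of a relation among images of distinct
  admissible monomials, which are independent.\<close>

lemma reduced_eq_0:
  assumes "reduced h" "presentation_map h = 0"
  shows "h = 0"
proof -
  let ?S = "{(I, E). xu_mono I E \<in> Poly_Mapping.keys h}"
  have fin: "finite ?S"
    by (rule finite_imageD[of "\<lambda>(I, E). xu_mono I E"])
      (auto simp: inj_on_def intro: finite_subset[OF _ finite_keys[of h]])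
  have sub: "?S \<subseteq> admissible_products n"
    using assms(1) by (auto simp: reduced_def)
  have sum: "(\<Sum>P\<in>?S. scale (Poly_Mapping.lookup h (xu_mono (fst P) (snd P))) (generator_product P)) = 0"
    using assms(2) unfolding presentation_map_reduced[OF assms(1)] by (simp add: split_def)
  note 0 = generator_product_independent[OF fin sub sum]
  have "?S = {}"
  proof (rule equals0I)
    fix P assume "P \<in> ?S"
    with 0[OF this] show False by (auto simp: in_keys_iff)
  qed
  with assms(1) have "Poly_Mapping.keys h = {}" unfolding reduced_def by fast
  then show ?thesis by simp
qed

lemma presentation_map_in_A:
  assumes "f \<in> carrier R"
  shows "presentation_map f \<in> A"
proof -
  obtain h where h: "f - h \<in> J" "reduced h" using remainder_poly_exists[OF assms] by blast
  have "presentation_map f = presentation_map h"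
    using presentation_map_J[OF h(1)] by (simp add: presentation_map_def psubst_diff)
  with presentation_map_reduced_in_A[OF h(2)] show ?thesis by simp
qed

text \<open>Modulo \<open>J\<close> any \<open>f\<close> equals a reduced \<open>h\<close> with the
  same image; if that image is 0, so is \<open>h\<close>.\<close>

lemma kernel_eq_J:
  assumes "f \<in> carrier R"
  shows "presentation_map f = 0 \<longleftrightarrow> f \<in> J"
proof
  assume 0: "presentation_map f = 0"
  obtain h where h: "f - h \<in> J" "reduced h" using remainder_poly_exists[OF assms] by blast
  have "presentation_map h = 0"
    using presentation_map_J[OF h(1)] 0 by (simp add: presentation_map_def psubst_diff psubst_uminus)
  with h(2) have "h = 0" by (rule reduced_eq_0)
  with h(1) show "f \<in> J" by simp
qed (rule presentation_map_J)

text \<open>Shows that the span is closed under multiplication, which its definition does not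
  reveal.\<close>

lemma A_eq_image: "A = presentation_map ` carrier R"
proof (intro antisym subsetI)
  fix f assume "f \<in> A"
  then show "f \<in> presentation_map ` carrier R"
    unfolding A_def
  proof (induction rule: mp.span_induct_alt)
    case base
    have "0 \<in> carrier R" using J_0 J_carrier by blast
    then show ?case by (force simp: presentation_map_def image_iff)
  next
    case (step c x y)
    then obtain I E g where "x = generator_product (I, E)" "(I, E) \<in> all_products n"
        "y = presentation_map g" "g \<in> carrier R"
      using admissible_subset_all by fastforce
    then have "scale c x + y = presentation_map (Poly_Mapping.single (xu_mono I E) c + g)"
      "Poly_Mapping.single (xu_mono I E) c + g \<in> carrier R"
      using presentation_map_single_xu_mono[of I E c] add_carrier xu_mono_carrier
      by (auto simp: presentation_map_def psubst_add)
    then show ?case by blast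
  qed
qed (use presentation_map_in_A in blast)

lemma A_mult: "f \<in> A \<Longrightarrow> g \<in> A \<Longrightarrow> f * g \<in> A"
  unfolding A_eq_image using mult_carrier by (force simp: presentation_map_def psubst_mult[symmetric])

lemma A_add: "f \<in> A \<Longrightarrow> g \<in> A \<Longrightarrow> f + g \<in> A"
  unfolding A_def by (rule mp.span_add)

lemma A_xv: "i \<in> {1..n} \<Longrightarrow> xv i \<in> A"
  unfolding A_eq_image
  by (intro image_eqI[of _ _ "xv i"] pvar_carrier) (simp_all add: presentation_map_def psubst_pvar)

lemma A_minor: "1 \<le> j \<Longrightarrow> j < k \<Longrightarrow> k \<le> n \<Longrightarrow> minor j k \<in> A"
  unfolding A_eq_image
  by (intro image_eqI[of _ _ "uv j k"] pvar_carrier) (simp_all add: presentation_map_def psubst_pvar)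

lemma A_constants: "A \<subseteq> carrier (constants_ring n)"
proof
  fix f assume "f \<in> A"
  then obtain g where g: "g \<in> carrier R" "f = presentation_map g" unfolding A_eq_image by blast
  from g(1) have "psubst generator g \<in> carrier (poly_ring (XY n)) \<and> Delta n (psubst generator g) = 0"
  proof (induction rule: carrier_poly_ring_induct)
    case (const c)
    then show ?case by (simp add: psubst_pconst Delta_pconst) (simp add: carrier_poly_ring pconst_def)
  next
    case (var v)
    have xy: "(xv i :: 'k mpoly) \<in> carrier (poly_ring (XY n))"
        "(yv i :: 'k mpoly) \<in> carrier (poly_ring (XY n))" if "i \<in> {1..n}" for i
      using that by (auto simp: XY_def carrier_poly_ring pvar_def)
    show ?case
    proof (cases v)
      case (U j k)
      then show ?thesis using var
        by (auto simp: psubst_pvar Delta_minor minor_def Delta_diff Delta_mult Delta_x Delta_y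
            intro!: poly_ring_closed xy)
    qed (use var xy in \<open>auto simp: psubst_pvar Delta_x\<close>)
  qed (auto simp: psubst_add psubst_mult Delta_add Delta_mult intro: poly_ring_closed)
  then show "f \<in> carrier (constants_ring n)"
    using g(2) by (simp add: carrier_constants_ring presentation_map_def)
qed

end

section \<open>The algebra of constants\<close>

lemma lookup_single_mult: "Poly_Mapping.lookup (Poly_Mapping.single a c * f) (a + m) = c * Poly_Mapping.lookup f m"
  for f :: "'k::comm_ring_1 mpoly"
  by (induction f rule: mpoly_induct)
    (simp_all add: mult_single lookup_single when_def lookup_add distrib_left)

text \<open>Multiplication by a variable only shifts exponents, so every coefficient of
  \<open>f\<close> reappears in the product.\<close>

lemma pvar_mult_eq_0:
  assumes "pvar v * f = 0"
  shows "f = 0"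
proof (rule poly_mapping_eqI)
  fix m
  show "Poly_Mapping.lookup f m = Poly_Mapping.lookup 0 m"
    using lookup_single_mult[of "Poly_Mapping.single v 1" 1 f m] assms by (simp add: pvar_def)
qed

text \<open>Characteristic 0 makes the integer factors produced by differentiation
  cancellable.\<close>

lemma of_nat_mult_eq_0:
  fixes f :: "'k::field_char_0 mpoly"
  assumes "of_nat (Suc k) * f = 0"
  shows "f = 0"
proof -
  have "scale (of_nat (Suc k)) f = 0"
    using assms unfolding scale_def pconst_def single_of_nat .
  then show ?thesis unfolding mp.scale_eq_0_iff of_nat_eq_0_iff by simp
qed

text \<open>\<open>Delta\<close> acts on polynomials in y_1 with constant coefficients as x_1 times
  the formal derivative. It lowers the degree, and the factors x_1 and k + 1 can be
  cancelled.\<close>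

lemma y1_transcendental:
  fixes h :: "nat \<Rightarrow> 'k::field_char_0 mpoly"
  assumes "n \<ge> 1" "\<And>k. Delta n (h k) = 0" "Delta n (\<Sum>k\<le>M. yv 1 ^ k * h k) = 0" "k \<in> {1..M}"
  shows "h k = 0"
proof -
  have dy: "Delta n (yv 1) = (xv 1 :: 'k mpoly)" using assms(1) by (intro Delta_y) simp
  have of_nat: "Delta n (of_nat j) = (0 :: 'k mpoly)" for j
    by (induction j) (simp_all add: Delta_add)
  have Delta_sum: "Delta n (\<Sum>k\<le>M. yv 1 ^ k * h k)
      = (\<Sum>k<M. yv 1 ^ k * (of_nat (Suc k) * (xv 1 * h (Suc k))))"
    if "\<And>k. Delta n (h k) = 0" for h :: "nat \<Rightarrow> 'k mpoly" and M
  proof -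
    have "Delta n (\<Sum>k\<le>M. yv 1 ^ k * h k) = (\<Sum>k\<le>M. Delta n (yv 1 ^ k * h k))"
      by (induction M) (simp_all add: Delta_add)
    also have "\<dots> = (\<Sum>k\<le>M. Delta n (yv 1 ^ k) * h k)"
      using that by (simp add: Delta_mult)
    also have "\<dots> = (\<Sum>k<M. Delta n (yv 1 ^ Suc k) * h (Suc k))"
      by (simp add: sum.atMost_shift)
    also have "\<dots> = (\<Sum>k<M. yv 1 ^ k * (of_nat (Suc k) * (xv 1 * h (Suc k))))"
      unfolding Delta_power dy by (simp only: ac_simps)
    finally show ?thesis .
  qed
  \<comment> \<open>Here the sum itself vanishes. The induction hypothesis for the differentiated
    sum gives all coefficients but \<open>h 0\<close>, which the original equation then
    yields.\<close>
  have zero: "h k = 0" if "\<And>k. Delta n (h k) = 0" "(\<Sum>k<M. yv 1 ^ k * h k) = 0" "k < M"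
    for h :: "nat \<Rightarrow> 'k mpoly" and M k
    using that
  proof (induction M arbitrary: h k)
    case (Suc M)
    let ?h = "\<lambda>k. of_nat (Suc k) * (xv 1 * h (Suc k))"
    have "Delta n (\<Sum>k\<le>M. yv 1 ^ k * h k) = 0"
      using Suc.prems(2) unfolding lessThan_Suc_atMost by (simp only: Delta_0)
    then have 1: "(\<Sum>k<M. yv 1 ^ k * ?h k) = 0"
      using Delta_sum[of h M, OF Suc.prems(1)] by (simp only:)
    have 2: "Delta n (?h k) = 0" for k
      by (simp only: Delta_mult Suc.prems(1) Delta_x of_nat mult_zero_left mult_zero_right add_0_left)
    have *: "h (Suc k) = 0" if "k < M" for k
      using Suc.IH[of ?h k, OF 2 1 that] by (rule pvar_mult_eq_0[OF of_nat_mult_eq_0])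
    have "h 0 = 0"
      using Suc.prems(2) unfolding sum.lessThan_Suc_shift by (simp add: *)
    with * Suc.prems(3) show ?case by (cases k) auto
  qed simp
  \<comment> \<open>The coefficient of index \<open>k - 1\<close> in the derivative carries
    \<open>h k\<close>. Only the derivative is known to vanish, so \<open>h 0\<close> remains
    free.\<close>
  have "of_nat (Suc (k - 1)) * (xv 1 * h (Suc (k - 1))) = 0"
  proof (rule zero[of "\<lambda>k. of_nat (Suc k) * (xv 1 * h (Suc k))" M])
    show "Delta n (of_nat (Suc k) * (xv 1 * h (Suc k))) = 0" for k
      by (simp only: Delta_mult assms(2) Delta_x of_nat mult_zero_left mult_zero_right add_0_left)
    show "(\<Sum>k<M. yv 1 ^ k * (of_nat (Suc k) * (xv 1 * h (Suc k)))) = 0"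
      using Delta_sum[of h M, OF assms(2)] assms(3) by (simp only:)
    show "k - 1 < M" using assms(4) by auto
  qed
  then have "h (Suc (k - 1)) = 0"
    by (rule pvar_mult_eq_0[OF of_nat_mult_eq_0])
  with assms(4) show ?thesis by simp
qed

lemma admissible_products_mono:
  assumes "(I, E) \<in> admissible_products n" "I' \<subseteq># I" "E' \<subseteq># E"
  shows "(I', E') \<in> admissible_products n"
  using assms unfolding admissible_products_def mem_Collect_eq prod.case
  by (blast dest: mset_subset_eqD)

section \<open>The constants lie in the span of the admissible products\<close>

context xu_ring
begin

text \<open>\<open>A_y1\<close> is the subring generated by \<open>A\<close> and \<open>y\<^sub>1\<close>.\<close>

inductive_set A_y1 :: "'k mpoly set" where
  base: "f \<in> A \<Longrightarrow> f \<in> A_y1"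
| step: "f \<in> A \<Longrightarrow> g \<in> A_y1 \<Longrightarrow> f + yv 1 * g \<in> A_y1"

lemma A_0: "0 \<in> A"
  unfolding A_def by (rule mp.span_zero)

lemma A_const: "pconst c \<in> A"
proof -
  have "(pconst c :: 'k mpoly) \<in> carrier R" by (simp add: carrier_poly_ring pconst_def)
  from presentation_map_in_A[OF this] show ?thesis by (simp add: presentation_map_def psubst_pconst)
qed

lemma A_1: "1 \<in> A"
  using A_const[of 1] by (simp add: pconst_def single_one)

lemma A_y1_add: "f \<in> A_y1 \<Longrightarrow> g \<in> A_y1 \<Longrightarrow> f + g \<in> A_y1"
proof (induction f arbitrary: g rule: A_y1.induct)
  case (base f)
  from base(2) show ?case
  proof cases
    case base
    with \<open>f \<in> A\<close> show ?thesis by (intro A_y1.base A_add)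
  next
    case (step f' g')
    then show ?thesis using A_y1.step[OF A_add[OF \<open>f \<in> A\<close> step(2)] step(3)] by (simp add: add.assoc)
  qed
next
  case (step f f')
  from step(4) show ?case
  proof cases
    case base
    then show ?thesis using A_y1.step[OF A_add[OF \<open>f \<in> A\<close> base] step(2)] by (simp add: ac_simps)
  next
    case (step h h')
    then show ?thesis
      using A_y1.step[OF A_add[OF \<open>f \<in> A\<close> step(2)] \<open>\<And>g. g \<in> A_y1 \<Longrightarrow> f' + g \<in> A_y1\<close>[OF step(3)]]
      by (simp add: algebra_simps)
  qed
qed

lemma A_y1_mult_A: "f \<in> A_y1 \<Longrightarrow> g \<in> A \<Longrightarrow> g * f \<in> A_y1"
proof (induction f rule: A_y1.induct)
  case (step f f')
  then show ?case using A_y1.step[OF A_mult[of g f], of "g * f'"] by (simp add: algebra_simps)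
qed (simp add: A_y1.base A_mult)

lemma A_y1_mult: "f \<in> A_y1 \<Longrightarrow> g \<in> A_y1 \<Longrightarrow> f * g \<in> A_y1"
proof (induction f rule: A_y1.induct)
  case (step f f')
  have "f * g \<in> A_y1" using step.prems step.hyps(1) by (rule A_y1_mult_A)
  moreover have "0 + yv 1 * (f' * g) \<in> A_y1" using A_0 step.IH[OF step.prems] by (rule A_y1.step)
  ultimately have "f * g + (0 + yv 1 * (f' * g)) \<in> A_y1" by (rule A_y1_add)
  then show ?case by (simp add: algebra_simps)
qed (simp add: A_y1_mult_A)

text \<open>Expands the Horner form in which \<open>A_y1\<close> is generated.\<close>

lemma A_y1_sum:
  "p \<in> A_y1 \<Longrightarrow> \<exists>M h. (\<forall>k. h k \<in> A) \<and> p = (\<Sum>k\<le>M. yv 1 ^ k * h k)"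
proof (induction p rule: A_y1.induct)
  case (base f)
  then show ?case by (intro exI[of _ 0] exI[of _ "\<lambda>_. f"]) simp
next
  case (step f g)
  then obtain M h where h: "\<forall>k. h k \<in> A" "g = (\<Sum>k\<le>M. yv 1 ^ k * h k)" by blast
  have "f + yv 1 * g = (\<Sum>k\<le>Suc M. yv 1 ^ k * (case k of 0 \<Rightarrow> f | Suc j \<Rightarrow> h j))"
    unfolding h(2) sum.atMost_Suc_shift by (simp add: sum_distrib_left mult.assoc)
  then show ?case
    using step(1) h(1) by (intro exI[of _ "Suc M"] exI[of _ "case_nat f h"]) (auto split: nat.split)
qed

lemma A_y1_constant:
  assumes "n \<ge> 1" "p \<in> A_y1" "Delta n p = 0"
  shows "p \<in> A"
proof -
  obtain M h where h: "\<forall>k. h k \<in> A" "p = (\<Sum>k\<le>M. yv 1 ^ k * h k)"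
    using A_y1_sum[OF assms(2)] by blast
  have "Delta n (h k) = 0" for k
    using h(1) A_constants by (auto simp: carrier_constants_ring)
  then have "h k = 0" if "k \<in> {1..M}" for k
    using y1_transcendental[OF assms(1), of h M k] assms(3) that unfolding h(2) by blast
  then have "p = h 0"
    unfolding h(2) sum.atMost_shift by (simp add: Suc_le_eq)
  with h(1) show ?thesis by simp
qed

lemma x1_power_mult_in_A_y1:
  assumes "n \<ge> 1" "f \<in> carrier (poly_ring (XY n))"
  shows "\<exists>N. xv 1 ^ N * f \<in> A_y1"
proof -
  have x1: "xv 1 \<in> A" using assms(1) by (intro A_xv) simp
  have pow: "xv 1 ^ N \<in> A" for N by (induction N) (simp_all only: A_1 A_mult x1 power_0 power_Suc)
  from assms(2) show ?thesis
  proof (induction rule: carrier_poly_ring_induct)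
    case (const c)
    have "xv 1 ^ 0 * pconst c \<in> A_y1" using A_const by (simp add: A_y1.base)
    then show ?case ..
  next
    case (var v)
    then consider i where "v = X i" "i \<in> {1..n}" | "v = Y 1" | i where "v = Y i" "i \<in> {2..n}"
      by (force simp: XY_def)
    then show ?case
    proof cases
      case 1
      then have "xv 1 ^ 0 * pvar v \<in> A_y1" using A_xv by (simp add: A_y1.base)
      then show ?thesis ..
    next
      case 2
      have "0 + yv 1 * 1 \<in> A_y1" by (intro A_y1.step[OF A_0 A_y1.base] A_1)
      then have "xv 1 ^ 0 * pvar v \<in> A_y1" using 2 by simp
      then show ?thesis ..
    next
      case 3
      \<comment> \<open>One power of x_1 suffices for y_i, since x_1 y_i = u_1i + y_1 x_i.\<close>
      have "minor 1 i + yv 1 * xv i \<in> A_y1"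
        using 3 by (intro A_y1.step[OF _ A_y1.base] A_minor A_xv) auto
      then have "xv 1 ^ 1 * pvar v \<in> A_y1" using 3 by (simp add: minor_def mult.commute)
      then show ?thesis ..
    qed
  next
    case (add f g)
    then obtain N M where NM: "xv 1 ^ N * f \<in> A_y1" "xv 1 ^ M * g \<in> A_y1" by blast
    \<comment> \<open>Both summands are brought to the common exponent N + M.\<close>
    then have "xv 1 ^ M * (xv 1 ^ N * f) + xv 1 ^ N * (xv 1 ^ M * g) \<in> A_y1"
      by (intro A_y1_add A_y1_mult_A[OF NM(1) pow] A_y1_mult_A[OF NM(2) pow])
    then have "xv 1 ^ (N + M) * (f + g) \<in> A_y1" by (simp add: power_add algebra_simps)
    then show ?case ..
  next
    case (mult f g)
    then obtain N M where "xv 1 ^ N * f \<in> A_y1" "xv 1 ^ M * g \<in> A_y1" by blast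
    then have "xv 1 ^ N * f * (xv 1 ^ M * g) \<in> A_y1" by (rule A_y1_mult)
    then have "xv 1 ^ (N + M) * (f * g) \<in> A_y1" by (simp add: power_add ac_simps)
    then show ?case ..
  qed
qed

text \<open>Setting x_1 = 0 in the expansion of \<open>xv 1 * g\<close> kills the coefficients of
  all products without x_1, by \<open>independent_mod_x1\<close>. The rest contain x_1, and removing
  one such factor keeps a product admissible.\<close>

lemma A_divide_x1:
  assumes "xv 1 * g \<in> A"
  shows "g \<in> A"
proof -
  obtain t r where t: "finite t" "t \<subseteq> generator_product ` admissible_products n"
      "xv 1 * g = (\<Sum>a\<in>t. scale (r a) a)"
    using assms unfolding A_def mp.span_explicit mem_Collect_eq by (elim exE conjE)
  \<comment> \<open>One index pair is chosen per element of \<open>t\<close>, so that the sum can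
    run over pairs.\<close>
  obtain S where S: "S \<subseteq> admissible_products n" "inj_on (generator_product :: _ \<Rightarrow> 'k mpoly) S"
      "t = generator_product ` S"
    using t(2) unfolding subset_image_inj by (elim exE conjE)
  have "finite S" using t(1) S(2,3) by (simp add: finite_image_iff)
  define c where "c P = r (generator_product P)" for P
  have eq: "xv 1 * g = (\<Sum>P\<in>S. scale (c P) (generator_product P))"
    unfolding t(3) S(3) c_def by (simp add: sum.reindex[OF S(2)])
  have "psubst kill_x1 (xv 1 * g) = 0"
    by (simp add: psubst_mult psubst_pvar kill_x1_def)
  from this[unfolded eq] have c0: "c P = 0" if "P \<in> S" "1 \<notin># fst P" for P
    using that by (rule independent_mod_x1[OF \<open>finite S\<close> S(1)])
  let ?T = "{P \<in> S. 1 \<in># fst P}"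
  let ?d = "\<lambda>P. (fst P - {#1#}, snd P)"
  have "xv 1 * g = (\<Sum>P\<in>?T. scale (c P) (generator_product P))"
    unfolding eq
  proof (intro sum.mono_neutral_right \<open>finite S\<close> ballI)
    fix P assume "P \<in> S - ?T"
    then have "c P = 0" by (intro c0) simp_all
    then show "scale (c P) (generator_product P) = 0" by simp
  qed simp
  also have "\<dots> = xv 1 * (\<Sum>P\<in>?T. scale (c P) (generator_product (?d P)))"
    unfolding sum_distrib_left
  proof (rule sum.cong[OF refl])
    fix P assume "P \<in> ?T"
    then have "1 \<in># fst P" by simp
    then obtain I where I: "fst P = add_mset 1 I" by (rule mset_add)
    have "generator_product P = xv 1 * (generator_product (?d P) :: 'k mpoly)"
      using I by (cases P) (simp add: generator_product_def mult.assoc)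
    then show "scale (c P) (generator_product P) = xv 1 * scale (c P) (generator_product (?d P))"
      by (simp only: scale_mult)
  qed
  finally have "xv 1 * (g - (\<Sum>P\<in>?T. scale (c P) (generator_product (?d P)))) = 0"
    by (simp only: right_diff_distrib diff_self)
  from pvar_mult_eq_0[OF this] have "g = (\<Sum>P\<in>?T. scale (c P) (generator_product (?d P)))"
    by simp
  also have "\<dots> \<in> A"
    unfolding A_def
  proof (intro mp.span_sum mp.span_scale mp.span_base imageI)
    fix P assume "P \<in> ?T"
    then have "(fst P, snd P) \<in> admissible_products n" using S(1) by auto
    then show "?d P \<in> admissible_products n" by (rule admissible_products_mono) simp_all
  qed
  finally show ?thesis .
qed

text \<open>A power of x_1 moves a constant \<open>f\<close> into \<open>A_y1\<close>. The product
  is still a constant, hence lies in \<open>A\<close>, and x_1 is divided out one factor at a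
  time.\<close>

lemma A_eq_constants:
  assumes "n \<ge> 1"
  shows "A = carrier (constants_ring n)"
proof (intro antisym subsetI)
  fix f :: "'k mpoly" assume f: "f \<in> carrier (constants_ring n)"
  obtain N where N: "xv 1 ^ N * f \<in> A_y1"
    using x1_power_mult_in_A_y1[OF assms] f unfolding carrier_constants_ring by blast
  have "Delta n (xv 1 ^ N) = (0 :: 'k mpoly)"
    by (induction N) (simp_all add: Delta_mult Delta_x)
  then have "Delta n (xv 1 ^ N * f) = 0"
    using f by (simp add: Delta_mult carrier_constants_ring)
  with N have "xv 1 ^ N * f \<in> A" by (intro A_y1_constant assms)
  then show "f \<in> A"
  proof (induction N)
    case (Suc N)
    then have "xv 1 * (xv 1 ^ N * f) \<in> A" by (simp only: power_Suc mult.assoc)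
    then show ?case by (rule Suc.IH[OF A_divide_x1])
  qed simp
qed (use A_constants in blast)

end

section \<open>The reduced Groebner basis\<close>

lemma leading_monomial_eqI:
  assumes "m \<in> Poly_Mapping.keys f" "\<And>m'. m' \<in> Poly_Mapping.keys f \<Longrightarrow> m' \<noteq> m \<Longrightarrow> gt m m'"
    and "\<And>m'. m' \<in> Poly_Mapping.keys f \<Longrightarrow> gt m m' \<Longrightarrow> \<not> gt m' m"
  shows "leading_monomial gt f = m"
  unfolding leading_monomial_def
proof (rule the_equality)
  fix m' assume m': "m' \<in> Poly_Mapping.keys f \<and> (\<forall>m''\<in>Poly_Mapping.keys f. m'' \<noteq> m' \<longrightarrow> gt m' m'')"
  show "m' = m"
  proof (rule ccontr)
    assume "m' \<noteq> m"
    then have "gt m m'" "gt m' m" using m' assms(1,2) by auto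
    with assms(3) m' show False by blast
  qed
qed (use assms(1,2) in blast)

lemma dill_gt_asym: "dill_gt I E I' E' \<Longrightarrow> \<not> dill_gt I' E' I E"
  using dill_gt_trans dill_gt_irrefl by blast

lemma leading_monomial_dill:
  assumes "xu_mono I E \<in> Poly_Mapping.keys f"
    and "\<And>m. m \<in> Poly_Mapping.keys f \<Longrightarrow> m \<noteq> xu_mono I E \<Longrightarrow> \<exists>I' E'. m = xu_mono I' E' \<and> dill_gt I E I' E'"
  shows "leading_monomial dill_greater f = xu_mono I E"
proof (rule leading_monomial_eqI[OF assms(1)])
  fix m assume "m \<in> Poly_Mapping.keys f" "m \<noteq> xu_mono I E"
  from assms(2)[OF this] show "dill_greater (xu_mono I E) m" by (auto simp: dill_greater_iff)
next
  fix m assume m: "m \<in> Poly_Mapping.keys f" "dill_greater (xu_mono I E) m"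
  then have "m \<noteq> xu_mono I E" using dill_greater_iff dill_gt_irrefl by blast
  with assms(2) m obtain I' E' where "m = xu_mono I' E'" "dill_gt I E I' E'" by blast
  then show "\<not> dill_greater m (xu_mono I E)" using dill_gt_asym by (simp add: dill_greater_iff)
qed

lemma rel_r_eq: "rel_r i j k l =
    Poly_Mapping.single (xu_mono {#} {#(i, j), (k, l)#}) 1
    - Poly_Mapping.single (xu_mono {#} {#(i, k), (j, l)#}) 1
    + Poly_Mapping.single (xu_mono {#} {#(i, l), (j, k)#}) 1"
  by (simp add: rel_r_def uv_eq_single single_xu_mono_mult add_mset_commute)

lemma rel_s_eq: "rel_s i j k =
    Poly_Mapping.single (xu_mono {#i#} {#(j, k)#}) 1
    - Poly_Mapping.single (xu_mono {#j#} {#(i, k)#}) 1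
    + Poly_Mapping.single (xu_mono {#k#} {#(i, j)#}) 1"
  by (simp add: rel_s_def uv_eq_single xv_eq_single single_xu_mono_mult)

lemma keys_three_terms:
  fixes a b c :: monomial
  assumes "a \<noteq> b" "b \<noteq> c" "a \<noteq> c"
  shows "Poly_Mapping.keys (Poly_Mapping.single a 1 - Poly_Mapping.single b 1
    + Poly_Mapping.single c (1::'k::field)) = {a, b, c}"
  using assms by (auto simp: in_keys_iff lookup_add lookup_minus lookup_single when_def split: if_splits)

lemma keys_rel_r:
  assumes "i < j" "j < k" "k < l"
  shows "Poly_Mapping.keys (rel_r i j k l :: 'k::field mpoly) =
    {xu_mono {#} {#(i, j), (k, l)#}, xu_mono {#} {#(i, k), (j, l)#}, xu_mono {#} {#(i, l), (j, k)#}}"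
  unfolding rel_r_eq using assms by (intro keys_three_terms) (auto simp: doubleton_eq_iff dest!: arg_cong[of _ _ set_mset])

lemma keys_rel_s:
  assumes "i < j" "j < k"
  shows "Poly_Mapping.keys (rel_s i j k :: 'k::field mpoly) =
    {xu_mono {#i#} {#(j, k)#}, xu_mono {#j#} {#(i, k)#}, xu_mono {#k#} {#(i, j)#}}"
  unfolding rel_s_eq using assms by (intro keys_three_terms) auto

lemma leading_monomial_rel_r:
  assumes "i < j" "j < k" "k < l"
  shows "leading_monomial dill_greater (rel_r i j k l :: 'k::field mpoly) = xu_mono {#} {#(i, k), (j, l)#}"
  by (rule leading_monomial_dill) (use dill_gt_r[OF assms] in \<open>auto simp: keys_rel_r[OF assms]\<close>)

lemma leading_monomial_rel_s:
  assumes "i < j" "j < k"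
  shows "leading_monomial dill_greater (rel_s i j k :: 'k::field mpoly) = xu_mono {#j#} {#(i, k)#}"
  by (rule leading_monomial_dill) (use dill_gt_s[OF assms] in \<open>auto simp: keys_rel_s[OF assms]\<close>)

lemma mono_dvd_xu_mono: "mono_dvd (xu_mono I E) (xu_mono I' E') \<longleftrightarrow> I \<subseteq># I' \<and> E \<subseteq># E'"
proof
  assume "mono_dvd (xu_mono I E) (xu_mono I' E')"
  then obtain c where c: "xu_mono I' E' = xu_mono I E + c" unfolding mono_dvd_def ..
  have "count I i \<le> count I' i" for i
    using arg_cong[OF c, of "\<lambda>m. Poly_Mapping.lookup m (X i)"] by (simp add: lookup_add)
  moreover have "count E e \<le> count E' e" for e
    using arg_cong[OF c, of "\<lambda>m. Poly_Mapping.lookup m (U (fst e) (snd e))"] by (simp add: lookup_add)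
  ultimately show "I \<subseteq># I' \<and> E \<subseteq># E'" by (simp add: subseteq_mset_def)
next
  assume "I \<subseteq># I' \<and> E \<subseteq># E'"
  then have "xu_mono I' E' = xu_mono I E + xu_mono (I' - I) (E' - E)" by (simp add: xu_mono_add)
  then show "mono_dvd (xu_mono I E) (xu_mono I' E')" unfolding mono_dvd_def ..
qed

section \<open>The Groebner basis property and reducedness\<close>

context xu_ring
begin

lemma leading_monomial_exists:
  assumes "f \<in> carrier R" "f \<noteq> 0"
  obtains I E where "(I, E) \<in> all_products n" "xu_mono I E \<in> Poly_Mapping.keys f"
    "\<And>m. m \<in> Poly_Mapping.keys f \<Longrightarrow> m \<noteq> xu_mono I E \<Longrightarrow> \<exists>I' E'. m = xu_mono I' E' \<and> dill_gt I E I' E'"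
proof -
  \<comment> \<open>A finite nonempty set has a largest element. Monomials in \<open>XU n\<close>
    are represented by pairs of multisets, on which the order is total.\<close>
  have "\<exists>m\<in>S. \<forall>m'\<in>S. m' \<noteq> m \<longrightarrow> dill_greater m m'"
    if "finite S" "S \<noteq> {}" "\<And>m. m \<in> S \<Longrightarrow> Poly_Mapping.keys m \<subseteq> XU n" for S
    using that
  proof (induction S rule: finite_ne_induct)
    case (insert a S)
    then obtain m where m: "m \<in> S" "\<forall>m'\<in>S. m' \<noteq> m \<longrightarrow> dill_greater m m'" by auto
    obtain I E where IE: "m = xu_mono I E" using insert.prems[of m] m(1) by (auto elim: XU_monomialE)
    obtain I' E' where IE': "a = xu_mono I' E'" using insert.prems[of a] by (auto elim: XU_monomialE)
    have "a \<noteq> m" using insert.hyps m by auto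
    then consider "dill_gt I E I' E'" | "dill_gt I' E' I E" using dill_gt_total[of I I' E E'] IE IE' by blast
    then show ?case
    proof cases
      case 1
      then have "dill_greater m a" by (simp add: IE IE' dill_greater_iff)
      with m show ?thesis by (intro bexI[of _ m]) auto
    next
      case 2
      have "dill_greater a m'" if "m' \<in> S" for m'
      proof (cases "m' = m")
        case True
        with 2 show ?thesis by (simp add: IE IE' dill_greater_iff)
      next
        case False
        have "Poly_Mapping.keys m' \<subseteq> XU n" using insert.prems that by simp
        then obtain I'' E'' where "m' = xu_mono I'' E''" by (rule XU_monomialE)
        moreover have "dill_greater m m'" using m(2) that False by blast
        ultimately show ?thesis
          using dill_gt_trans[OF 2] by (simp add: IE IE' dill_greater_iff)
      qed
      then show ?thesis by (intro bexI[of _ a]) auto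
    qed
  qed simp
  from this[of "Poly_Mapping.keys f"] obtain m where m: "m \<in> Poly_Mapping.keys f"
      "\<forall>m'\<in>Poly_Mapping.keys f. m' \<noteq> m \<longrightarrow> dill_greater m m'"
    using assms by (auto simp: carrier_poly_ring)
  have XU: "\<exists>I E. (I, E) \<in> all_products n \<and> m' = xu_mono I E" if "m' \<in> Poly_Mapping.keys f" for m'
  proof -
    have "Poly_Mapping.keys m' \<subseteq> XU n" using assms(1) that unfolding carrier_poly_ring by blast
    then show ?thesis by (rule XU_monomialE) blast
  qed
  from XU[OF m(1)] obtain I E where IE: "(I, E) \<in> all_products n" "m = xu_mono I E" by blast
  show thesis
  proof (rule that[OF IE(1)])
    fix m' assume "m' \<in> Poly_Mapping.keys f" "m' \<noteq> xu_mono I E"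
    moreover from XU[OF this(1)] obtain I' E' where "m' = xu_mono I' E'" by blast
    ultimately show "\<exists>I' E'. m' = xu_mono I' E' \<and> dill_gt I E I' E'"
      using m(2) IE(2) by (auto simp: dill_greater_iff)
  qed (use m IE in simp)
qed

text \<open>Suppose the leading monomial of \<open>f\<close> in \<open>J\<close> were admissible.
  Replacing the other terms by a remainder gives a reduced element of \<open>J\<close> in which the
  leading term survives, contradicting \<open>reduced_eq_0\<close>. So it is not admissible, and
  \<open>not_admissible_cases\<close> exhibits a dividing leading monomial.\<close>

lemma groebner: "groebner_basis dill_greater R J (rels_R n \<union> rels_S n)"
  unfolding groebner_basis_def
proof (intro conjI ballI impI)
  fix f assume f: "f \<in> J" "f \<noteq> 0"
  obtain I E where IE: "(I, E) \<in> all_products n" "xu_mono I E \<in> Poly_Mapping.keys f"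
    "\<And>m. m \<in> Poly_Mapping.keys f \<Longrightarrow> m \<noteq> xu_mono I E \<Longrightarrow> \<exists>I' E'. m = xu_mono I' E' \<and> dill_gt I E I' E'"
    using J_carrier[OF f(1)] f(2) by (rule leading_monomial_exists) (rule that; assumption)
  have lead: "leading_monomial dill_greater f = xu_mono I E"
    using IE(2,3) by (rule leading_monomial_dill)
  have "(I, E) \<notin> admissible_products n"
  proof
    assume adm: "(I, E) \<in> admissible_products n"
    let ?L = "Poly_Mapping.single (xu_mono I E) (Poly_Mapping.lookup f (xu_mono I E))"
    have keys: "m \<in> Poly_Mapping.keys (f - ?L) \<longleftrightarrow> m \<in> Poly_Mapping.keys f \<and> m \<noteq> xu_mono I E" for m
      by (auto simp: in_keys_iff lookup_minus lookup_single when_def)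
    have "f - ?L \<in> carrier R"
      using J_carrier[OF f(1)] xu_mono_carrier[OF IE(1)] by (rule diff_carrier)
    then obtain h where h: "f - ?L - h \<in> J" "reduced h"
      "\<And>I' E'. xu_mono I' E' \<in> Poly_Mapping.keys h \<Longrightarrow>
        \<exists>I E. xu_mono I E \<in> Poly_Mapping.keys (f - ?L) \<and> (I' = I \<and> E' = E \<or> dill_gt I E I' E')"
      by (rule remainder_poly_exists) (rule that; assumption)
    \<comment> \<open>All monomials of \<open>h\<close> are bounded by monomials of \<open>f\<close>
      strictly below the leading one, so nothing can cancel \<open>?L\<close>.\<close>
    have "xu_mono I E \<notin> Poly_Mapping.keys h"
    proof
      assume "xu_mono I E \<in> Poly_Mapping.keys h"
      from h(3)[OF this] obtain I' E' where *: "xu_mono I' E' \<in> Poly_Mapping.keys f" "xu_mono I' E' \<noteq> xu_mono I E"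
        "I = I' \<and> E = E' \<or> dill_gt I' E' I E" unfolding keys by blast
      from IE(3)[OF *(1,2)] have "dill_gt I E I' E'" by auto
      with *(2,3) dill_gt_asym show False by auto
    qed
    then have "Poly_Mapping.lookup (?L + h) (xu_mono I E) \<noteq> 0"
      using IE(2) by (simp add: lookup_add in_keys_iff)
    then have "?L + h \<noteq> 0" by force
    moreover have "reduced (?L + h)"
      using h(2) adm Poly_Mapping.keys_add[of ?L h] by (fastforce simp: reduced_def split: if_splits)
    moreover have "presentation_map (?L + h) = 0"
    proof (rule presentation_map_J)
      \<comment> \<open>It equals f - (f - ?L - h).\<close>
      show "?L + h \<in> J" using J_diff[OF f(1) h(1)] by simp
    qed
    ultimately show False using reduced_eq_0 by blast
  qed
  with IE(1) show "\<exists>g\<in>(rels_R n \<union> rels_S n :: 'k mpoly set). g \<noteq> 0 \<and>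
      mono_dvd (leading_monomial dill_greater g) (leading_monomial dill_greater f)"
  proof (cases rule: not_admissible_cases)
    case (r i j k l E0)
    have "rel_r i j k l \<in> (rels_R n :: 'k mpoly set)"
      using IE(1) r unfolding rels_R_def all_products_def by fastforce
    moreover have "rel_r i j k l \<noteq> (0 :: 'k mpoly)"
      using keys_rel_r[OF r(1-3), where 'k='k] by auto
    ultimately show ?thesis
      using leading_monomial_rel_r[OF r(1-3), where 'k='k] r(4)
      by (intro bexI[of _ "rel_r i j k l"]) (simp_all add: mono_dvd_xu_mono lead)
  next
    case (s i j k I0 E0)
    have "rel_s i j k \<in> (rels_S n :: 'k mpoly set)"
      using IE(1) s unfolding rels_S_def all_products_def by fastforce
    moreover have "rel_s i j k \<noteq> (0 :: 'k mpoly)"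
      using keys_rel_s[OF s(1-2), where 'k='k] by auto
    ultimately show ?thesis
      using leading_monomial_rel_s[OF s(1-2), where 'k='k] s(3,4)
      by (intro bexI[of _ "rel_s i j k"]) (simp_all add: mono_dvd_xu_mono lead)
  qed
qed (use rels_carrier in \<open>auto simp: rel_ideal_def\<close>)

lemma rels_cases:
  assumes "g \<in> rels_R n \<union> rels_S n"
  obtains (r) i j k l where "i < j" "j < k" "k < l" "g = (rel_r i j k l :: 'k mpoly)"
    | (s) i j k where "i < j" "j < k" "g = rel_s i j k"
  using assms unfolding rels_R_def rels_S_def by blast

text \<open>Between two relations of one kind, divisibility is equality of monomials, and only the
  middle monomial of a relation has a crossing pair or a covered factor; it determines the indices.
  Between different kinds the x-degree or the u-degree rules it out.\<close>

lemma reduced_groebner: "reduced_groebner_basis dill_greater R J (rels_R n \<union> rels_S n)"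
  unfolding reduced_groebner_basis_def
proof (intro conjI ballI groebner)
  show "0 \<notin> (rels_R n \<union> rels_S n :: 'k mpoly set)"
  proof
    assume "0 \<in> (rels_R n \<union> rels_S n :: 'k mpoly set)"
    then show False
    proof (cases rule: rels_cases)
      case (r i j k l)
      with keys_rel_r[OF r(1-3), where 'k='k] show False by (metis insert_not_empty keys_zero)
    next
      case (s i j k)
      with keys_rel_s[OF s(1-2), where 'k='k] show False by (metis insert_not_empty keys_zero)
    qed
  qed
next
  fix g h :: "'k mpoly" and m
  assume g: "g \<in> rels_R n \<union> rels_S n" and m: "m \<in> Poly_Mapping.keys g"
    and h: "h \<in> rels_R n \<union> rels_S n - {g}"
  show "\<not> mono_dvd (leading_monomial dill_greater h) m"
  proof
    assume dvd: "mono_dvd (leading_monomial dill_greater h) m"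
    from h have "h \<in> rels_R n \<union> rels_S n" by blast
    then have "h = g"
    proof (cases rule: rels_cases)
      case h: (r i j k l)
      note dvd = dvd[unfolded h(4) leading_monomial_rel_r[OF h(1-3)]]
      from g show ?thesis
      proof (cases rule: rels_cases)
        case (r i' j' k' l')
        with dvd m h show ?thesis
          by (auto simp: keys_rel_r[OF r(1-3)] mono_dvd_xu_mono dest!: set_mset_mono)
      next
        case (s i' j' k')
        with dvd m h show ?thesis
          by (auto simp: keys_rel_s[OF s(1-2)] mono_dvd_xu_mono dest!: size_mset_mono)
      qed
    next
      case h: (s i j k)
      note dvd = dvd[unfolded h(3) leading_monomial_rel_s[OF h(1-2)]]
      from g show ?thesis
      proof (cases rule: rels_cases)
        case (r i' j' k' l')
        with dvd m show ?thesis
          by (auto simp: keys_rel_r[OF r(1-3)] mono_dvd_xu_mono)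
      next
        case (s i' j' k')
        with dvd m h show ?thesis
          by (auto simp: keys_rel_s[OF s(1-2)] mono_dvd_xu_mono)
      qed
    qed
    with h show False by blast
  qed
qed

end

section \<open>The isomorphism and the basis\<close>

lemma ring_constants_ring: "ring (constants_ring n :: 'k::comm_ring_1 mpoly ring)"
proof -
  interpret P: cring "poly_ring (XY n) :: 'k mpoly ring" by (rule cring_poly_ring)
  have uminus: "\<ominus>\<^bsub>poly_ring (XY n)\<^esub> f = - f" if "f \<in> carrier (poly_ring (XY n))" for f :: "'k mpoly"
    using P.minus_equality[of "- f" f] that by (simp add: poly_ring_def)
  have ops: "f \<otimes>\<^bsub>poly_ring (XY n)\<^esub> g = f * g" "f \<oplus>\<^bsub>poly_ring (XY n)\<^esub> g = f + g"
    "\<one>\<^bsub>poly_ring (XY n)\<^esub> = (1 :: 'k mpoly)" for f g :: "'k mpoly"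
    by (simp_all add: poly_ring_def)
  have one: "1 \<in> carrier (poly_ring (XY n) :: 'k mpoly ring)"
    by (simp add: carrier_poly_ring)
  have "subring {f \<in> carrier (poly_ring (XY n)). Delta n f = (0 :: 'k mpoly)} (poly_ring (XY n))"
  proof (rule P.subringI)
    fix f :: "'k mpoly" assume "f \<in> {f \<in> carrier (poly_ring (XY n)). Delta n f = 0}"
    then show "\<ominus>\<^bsub>poly_ring (XY n)\<^esub> f \<in> {f \<in> carrier (poly_ring (XY n)). Delta n f = 0}"
      using P.a_inv_closed[of f] by (simp add: uminus Delta_uminus)
  qed (auto simp: ops one Delta_mult Delta_add intro: poly_ring_closed)
  then show ?thesis
    unfolding constants_ring_def by (rule P.subring_is_ring)
qed

context xu_ring
begin

lemma presentation:
  assumes "n \<ge> 1"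
  shows "\<exists>\<Phi>. \<Phi> \<in> ring_iso (R Quot J) (constants_ring n :: 'k mpoly ring) \<and>
    (\<forall>f \<in> carrier R. \<Phi> (J +>\<^bsub>R\<^esub> f) = presentation_map f)"
proof -
  let ?C = "constants_ring n :: 'k mpoly ring"
  have C_ops: "f \<otimes>\<^bsub>?C\<^esub> g = f * g" "f \<oplus>\<^bsub>?C\<^esub> g = f + g" "\<one>\<^bsub>?C\<^esub> = 1" "\<zero>\<^bsub>?C\<^esub> = 0" for f g
    by (simp_all add: constants_ring_def poly_ring_def)
  have image: "presentation_map ` carrier R = carrier ?C"
    using A_eq_image A_eq_constants[OF assms] by simp
  have hom: "ring_hom_ring R ?C presentation_map"
  proof (rule ring_hom_ringI2[OF R.ring_axioms ring_constants_ring], rule ring_hom_memI)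
    fix f assume "f \<in> carrier R"
    then show "presentation_map f \<in> carrier ?C" using image by blast
  qed (simp_all only: C_ops ops, simp_all add: presentation_map_def psubst_add psubst_mult)
  have "a_kernel R ?C presentation_map = J"
    unfolding a_kernel_def' using kernel_eq_J J_carrier by (auto simp: C_ops)
  with ring_hom_ring.FactRing_iso_set[OF hom image] ring_hom_ring.the_elem_simp[OF hom]
  \<comment> \<open>The induced map of the first isomorphism theorem:
    \<open>presentation_map\<close> is constant on each coset, and \<open>the_elem\<close> extracts
    its value.\<close>
  show ?thesis by (intro exI[of _ "\<lambda>X. the_elem (presentation_map ` X)"]) simp
qed

lemma basis:
  "inj_on (generator_product :: _ \<Rightarrow> 'k mpoly) (admissible_products n)"
  "\<not> mp.dependent (generator_product ` admissible_products n :: 'k mpoly set)"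
proof -
  show inj: "inj_on (generator_product :: _ \<Rightarrow> 'k mpoly) (admissible_products n)"
  proof (rule inj_onI, rule ccontr)
    fix P Q assume PQ: "P \<in> admissible_products n" "Q \<in> admissible_products n"
      "generator_product P = (generator_product Q :: 'k mpoly)" "P \<noteq> Q"
    \<comment> \<open>Two distinct index pairs with equal products would satisfy the forbidden
      relation with coefficients 1 and -1.\<close>
    let ?c = "\<lambda>a. if a = P then 1 else - 1 :: 'k"
    have "(\<Sum>a\<in>{P, Q}. scale (?c a) (generator_product a)) = 0"
      using PQ(3,4) by simp
    from generator_product_independent[OF _ _ this, of n P] PQ(1,2) show False by simp
  qed
  show "\<not> mp.dependent (generator_product ` admissible_products n :: 'k mpoly set)"
    unfolding mp.independent_explicit_module
  proof (intro allI impI)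
    fix t :: "'k mpoly set" and u v
    assume t: "finite t" "t \<subseteq> generator_product ` admissible_products n"
      "(\<Sum>v\<in>t. scale (u v) v) = 0" "v \<in> t"
    from t(2) obtain S where S: "S \<subseteq> admissible_products n" "inj_on (generator_product :: _ \<Rightarrow> 'k mpoly) S"
      "t = generator_product ` S" unfolding subset_image_inj by (elim exE conjE)
    obtain P where P: "P \<in> S" "v = generator_product P" using S(3) t(4) by blast
    have fin: "finite S" using t(1) S(2,3) by (simp add: finite_image_iff)
    have 0: "(\<Sum>P\<in>S. scale (u (generator_product P)) (generator_product P)) = 0"
      using t(3) unfolding S(3) by (simp add: sum.reindex[OF S(2)])
    show "u v = 0"
      using generator_product_independent[OF fin S(1) 0 P(1)] P(2) by simp
  qed
qed

end

theorem theorem5: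
  fixes n :: nat
  assumes "n \<ge> 1"
  shows
    "(\<exists>\<Phi>. \<Phi> \<in> ring_iso (poly_ring (XU n) Quot rel_ideal n)
                       (constants_ring n :: 'k::field_char_0 mpoly ring) \<and>
          (\<forall>f \<in> carrier (poly_ring (XU n)).
             \<Phi> (rel_ideal n +>\<^bsub>poly_ring (XU n)\<^esub> f) = presentation_map f)) \<and>
     reduced_groebner_basis dill_greater (poly_ring (XU n))
       (rel_ideal n) (rels_R n \<union> rels_S n :: 'k mpoly set) \<and>
     (inj_on (generator_product :: _ \<Rightarrow> 'k mpoly) (admissible_products n) \<and>
      \<not> module.dependent scale (generator_product ` admissible_products n :: 'k mpoly set) \<and>
      module.span scale (generator_product ` admissible_products n :: 'k mpoly set)
        = carrier (constants_ring n))"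
proof -
  interpret xu_ring n "TYPE('k)" .
  show ?thesis
    using presentation[OF assms] reduced_groebner basis A_eq_constants[OF assms]
    unfolding A_def by blast
qed

end
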